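(* Let $n\in\mathbb N$, let $A$ be a Young function with $A(t)\sim t^n(\log t)^q$ near infinity for some $q>n-1$, and let $\varphi$ be a gauge function with $\varphi(r)\sim(\log\frac1r)^\beta$ near zero for some $\beta<0$. Set $\sigma=\frac{n\beta}{n-q-1+\beta}$, let $\mu>1+\sigma$, and let $\phi$ be a gauge function with $\phi(r)\sim r^\sigma(\log\frac1r)^\mu$ near zero. Then there exist a map $u\in V^{1,A}(\mathbb R^n,\mathbb R^n)$ and a compact set $E\subset\mathbb R^n$ such that $0<\mathscr H^\varphi(E)<\infty$ and $\mathscr H^\phi(u(E))=\infty$.
   Context: A gauge function is an increasing continuous function $\phi\colon[0,\infty)\to[0,\infty)$ vanishing only at $0$. For $E\subset\mathbb R^k$, $\mathscr H^\phi(E)=\lim_{\sigma\to0^+}\inf\{\sum_i\phi(d(E_i)): d(E_i)\le\sigma, E\subset\bigcup_iE_i\}$ ($d$ = diameter). A Young function is a non-trivial convex $A\colon[0,\infty)\to[0,\infty]$ with $A(0)=0$; $L^A$ is the Orlicz space with Luxemburg norm $\|f\|_{L^A}=\inf\{\lambda>0:\int A(|f|/\lambda)\le1\}$, and $V^{1,A}(\mathbb R^n,\mathbb R^n)$ is the space of weakly differentiable $u\in L^1_{\rm loc}$ with $|\nabla u|\in L^A(\mathbb R^n)$ (continuous representative used). "$f\sim g$ near zero (near infinity)" means $c^{-1}g\le f\le cg$ on some interval $(0,r_0)$ (on some $(t_0,\infty)$) for a constant $c>0$. *)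

theory Defs
  imports "HOL-Analysis.Analysis"
begin

definition gauge_function :: "(real \<Rightarrow> real) \<Rightarrow> bool" where
  "gauge_function \<phi> \<longleftrightarrow> mono_on {0..} \<phi> \<and> continuous_on {0..} \<phi> \<and> \<phi> 0 = 0
      \<and> (\<forall>t>0. \<phi> t > 0)"

definition hausdorff_pre :: "(real \<Rightarrow> real) \<Rightarrow> real \<Rightarrow> 'a::euclidean_space set \<Rightarrow> ennreal" where
  "hausdorff_pre \<phi> \<delta> E =
     (INF C \<in> {C :: nat \<Rightarrow> 'a set. E \<subseteq> (\<Union>i. C i) \<and>
                 (\<forall>i. bounded (C i) \<and> diameter (C i) \<le> \<delta>)}.
        \<Sum>i. ennreal (\<phi> (diameter (C i))))"

text \<open>Gauge Hausdorff measure: the limit as delta tends to 0+, which (by monotonicity in delta)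
  is the supremum over delta > 0.\<close>
definition hausdorff_gauge :: "(real \<Rightarrow> real) \<Rightarrow> 'a::euclidean_space set \<Rightarrow> ennreal" where
  "hausdorff_gauge \<phi> E = (SUP \<delta> \<in> {0<..}. hausdorff_pre \<phi> \<delta> E)"

definition young_function :: "(real \<Rightarrow> real) \<Rightarrow> bool" where
  "young_function A \<longleftrightarrow> convex_on {0..} A \<and> A 0 = 0 \<and> (\<forall>t\<ge>0. A t \<ge> 0) \<and> (\<exists>t>0. A t > 0)"

definition equiv_at_infinity :: "(real \<Rightarrow> real) \<Rightarrow> (real \<Rightarrow> real) \<Rightarrow> bool" where
  "equiv_at_infinity f g \<longleftrightarrow> (\<exists>c>0. \<exists>t0. \<forall>t>t0. g t / c \<le> f t \<and> f t \<le> c * g t)"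

definition equiv_near_zero :: "(real \<Rightarrow> real) \<Rightarrow> (real \<Rightarrow> real) \<Rightarrow> bool" where
  "equiv_near_zero f g \<longleftrightarrow> (\<exists>c>0. \<exists>r0>0. \<forall>r\<in>{0<..<r0}. g r / c \<le> f r \<and> f r \<le> c * g r)"

definition locally_integrable :: "('a::euclidean_space \<Rightarrow> 'b::{banach,second_countable_topology}) \<Rightarrow> bool" where
  "locally_integrable f \<longleftrightarrow> (\<forall>K. compact K \<longrightarrow> set_integrable lebesgue K f)"

definition partial_deriv :: "'n::finite \<Rightarrow> (real^'n \<Rightarrow> real) \<Rightarrow> real^'n \<Rightarrow> real" where
  "partial_deriv j f x = frechet_derivative f (at x) (axis j 1)"

fun Ck :: "nat \<Rightarrow> (real^'n::finite \<Rightarrow> real) \<Rightarrow> bool" where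
  "Ck 0 f = continuous_on UNIV f"
| "Ck (Suc k) f = (continuous_on UNIV f \<and> (\<forall>x. f differentiable (at x)) \<and>
                   (\<forall>j. Ck k (partial_deriv j f)))"

definition test_function :: "(real^'n::finite \<Rightarrow> real) \<Rightarrow> bool" where
  "test_function \<psi> \<longleftrightarrow> (\<forall>k. Ck k \<psi>) \<and> compact (closure {x. \<psi> x \<noteq> 0})"

definition weak_gradient :: "(real^'n::finite \<Rightarrow> real^'n) \<Rightarrow> (real^'n \<Rightarrow> real^'n^'n) \<Rightarrow> bool" where
  "weak_gradient u G \<longleftrightarrow> locally_integrable u \<and> locally_integrable G \<and>
     (\<forall>\<psi>. test_function \<psi> \<longrightarrow> (\<forall>i j.
        (\<integral>x. u x $ i * partial_deriv j \<psi> x \<partial>lebesgue) = - (\<integral>x. G x $ i $ j * \<psi> x \<partial>lebesgue)))"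

text \<open>Membership in the Orlicz space L^A (Luxemburg norm finite).\<close>
definition in_orlicz :: "(real \<Rightarrow> real) \<Rightarrow> ('a::euclidean_space \<Rightarrow> real) \<Rightarrow> bool" where
  "in_orlicz A f \<longleftrightarrow> f \<in> borel_measurable lebesgue \<and>
     (\<exists>l>0. (\<integral>\<^sup>+ x. ennreal (A (\<bar>f x\<bar> / l)) \<partial>lebesgue) \<le> 1)"

text \<open>V^{1,A}(R^n,R^n): weakly differentiable, with |\<nabla>u| (Frobenius norm) in L^A.\<close>
definition V1A :: "(real \<Rightarrow> real) \<Rightarrow> (real^'n::finite \<Rightarrow> real^'n) set" where
  "V1A A = {u. \<exists>G. weak_gradient u G \<and> in_orlicz A (\<lambda>x. norm (G x))}"

end

theory Submission
  imports Defs "HOL-Probability.Probability" "HOL-Real_Asymp.Real_Asymp"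
begin

text \<open>
  Both \<open>E\<close> and \<open>u(E)\<close> are coded by sequences \<open>e\<close> of vectors in \<open>{0,1}^n\<close>: they consist of the
  points \<open>\<Sum>k. r k * e k\<close> and \<open>\<Sum>k. h k * e k\<close>. With \<open>m = 2 ^ n\<close> choose \<open>ln (1 / r k) = L * \<tau> ^ k\<close>
  where \<open>\<tau> powr (- \<beta>) = m\<close>, so that \<open>m ^ k * \<phi> (r k)\<close> stays bounded above and below, and
  \<open>h k = a k * x ^ k\<close> where \<open>x = m powr (- 1 / \<sigma>)\<close> and \<open>a k\<close> is proportional to the summable sequence
  \<open>k powr (- 1 - 1 / \<sigma>)\<close>, so that \<open>m ^ k * \<Phi> (h k)\<close> is at least of the order \<open>k powr (\<mu> - \<sigma> - 1)\<close>.
  The uniform product measure on codes turns this into lower bounds for the Hausdorff measures.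

  The map is \<open>u = \<Sum>k. h k * f k\<close>, where the field \<open>f k\<close> reads off the \<open>k\<close>-th digit of a point of \<open>E\<close>.
  It is a sum over the cylinders of level \<open>k\<close> of a digit times a cutoff depending on
  \<open>ln |y - c| / ln (r k)\<close>. Since \<open>ln (r k)\<close> grows geometrically, such a cutoff fits between two
  consecutive scales, and its gradient is of size \<open>1 / (|y - c| * L * \<tau> ^ k)\<close>. Hence \<open>x ^ k * f k\<close> costs
  the energy \<open>x ^ (n * k) * (L * \<tau> ^ k) powr (q + 1 - n)\<close> per cylinder. The formula for \<open>\<sigma>\<close> says exactly
  that these costs add up to the same total on every level, and convexity of \<open>A\<close> allows one to sum
  the levels with the weights \<open>a k\<close>.
\<close>

section \<open>Hausdorff measures of coded sets\<close>

lemma gauge_function_mono: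
  assumes "gauge_function \<psi>" "0 \<le> s" "s \<le> t"
  shows "\<psi> s \<le> \<psi> t"
  using assms mono_onD[of "{0..}" \<psi> s t] by (auto simp: gauge_function_def)

lemma gauge_function_nonneg: "gauge_function \<psi> \<Longrightarrow> 0 \<le> t \<Longrightarrow> 0 \<le> \<psi> t"
  using gauge_function_mono[of \<psi> 0 t] by (simp add: gauge_function_def)

lemma equiv_near_zeroE:
  assumes "equiv_near_zero f g"
  obtains c where "c > 0" "\<forall>\<^sub>F r in at_right 0. g r / c \<le> f r \<and> f r \<le> c * g r"
proof -
  obtain c r0 where "c > 0" "r0 > 0" and bounds: "\<forall>r\<in>{0<..<r0}. g r / c \<le> f r \<and> f r \<le> c * g r"
    using assms unfolding equiv_near_zero_def by blast
  moreover have "\<forall>\<^sub>F r in at_right 0. g r / c \<le> f r \<and> f r \<le> c * g r"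
    unfolding eventually_at_right_field using \<open>r0 > 0\<close> bounds by (intro exI[of _ r0]) simp
  ultimately show thesis using that by blast
qed

lemma hausdorff_gauge_ge_mass:
  fixes z :: "'c \<Rightarrow> 'a::euclidean_space"
  assumes "\<delta> > 0"
    and mass: "\<And>C. bounded C \<Longrightarrow> diameter C \<le> \<delta> \<Longrightarrow>
      \<exists>S\<in>sets M. z -` C \<inter> space M \<subseteq> S \<and> K * emeasure M S \<le> ennreal (\<psi> (diameter C))"
  shows "K * emeasure M (space M) \<le> hausdorff_gauge \<psi> (z ` space M)"
proof -
  have "K * emeasure M (space M) \<le> hausdorff_pre \<psi> \<delta> (z ` space M)"
    unfolding hausdorff_pre_def
  proof (rule INF_greatest, safe)
    fix C :: "nat \<Rightarrow> 'a set"
    assume cover: "z ` space M \<subseteq> (\<Union>i. C i)" and small_cover: "\<forall>i. bounded (C i) \<and> diameter (C i) \<le> \<delta>"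
    have "\<forall>i. \<exists>S\<in>sets M. z -` C i \<inter> space M \<subseteq> S \<and> K * emeasure M S \<le> ennreal (\<psi> (diameter (C i)))"
      using small_cover mass by blast
    then obtain S where S_cover: "\<And>i. S i \<in> sets M" "\<And>i. z -` C i \<inter> space M \<subseteq> S i"
      "\<And>i. K * emeasure M (S i) \<le> ennreal (\<psi> (diameter (C i)))" by metis
    have "x \<in> (\<Union>i. S i)" if "x \<in> space M" for x
    proof -
      obtain i where "z x \<in> C i" using cover \<open>x \<in> space M\<close> by blast
      then show ?thesis using S_cover(2)[of i] \<open>x \<in> space M\<close> by blast
    qed
    then have "emeasure M (space M) \<le> emeasure M (\<Union>i. S i)" using S_cover(1) by (intro emeasure_mono subsetI) auto
    also have "\<dots> \<le> (\<Sum>i. emeasure M (S i))" using S_cover(1) by (intro emeasure_subadditive_countably) auto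
    finally have "K * emeasure M (space M) \<le> K * (\<Sum>i. emeasure M (S i))"
      by (rule mult_left_mono) simp
    also have "\<dots> = (\<Sum>i. K * emeasure M (S i))" by simp
    also have "\<dots> \<le> (\<Sum>i. ennreal (\<psi> (diameter (C i))))" using S_cover(3) by (intro suminf_le) auto
    finally show "K * emeasure M (space M) \<le> (\<Sum>i. ennreal (\<psi> (diameter (C i))))" .
  qed
  also have "\<dots> \<le> hausdorff_gauge \<psi> (z ` space M)"
    unfolding hausdorff_gauge_def using \<open>\<delta> > 0\<close> by (intro SUP_upper) simp
  finally show ?thesis .
qed

lemma hausdorff_pre_le_finite_cover:
  fixes C :: "'i \<Rightarrow> 'a::euclidean_space set"
  assumes gauge: "gauge_function \<psi>" and "\<delta> \<ge> 0" and "finite I" and cover: "E \<subseteq> (\<Union>i\<in>I. C i)"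
    and C_small: "\<And>i. i \<in> I \<Longrightarrow> bounded (C i)" "\<And>i. i \<in> I \<Longrightarrow> diameter (C i) \<le> \<delta>"
  shows "hausdorff_pre \<psi> \<delta> E \<le> (\<Sum>i\<in>I. ennreal (\<psi> (diameter (C i))))"
proof -
  obtain h where bij_h: "bij_betw h {..<card I} I"
    using ex_bij_betw_nat_finite[OF \<open>finite I\<close>] by (auto simp: atLeast0LessThan)
  define D where "D j = (if j < card I then C (h j) else {})" for j
  have h_in_I: "h j \<in> I" if "j < card I" for j using bij_h that by (auto simp: bij_betw_def)
  have "E \<subseteq> (\<Union>j. D j)"
  proof
    fix x assume "x \<in> E"
    then obtain i where "i \<in> I" "x \<in> C i" using cover by blast
    moreover obtain j where "j < card I" "h j = i"
      using bij_betw_imp_surj_on[OF bij_h] \<open>i \<in> I\<close> by (metis imageE lessThan_iff)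
    ultimately have "x \<in> D j" by (simp add: D_def)
    then show "x \<in> (\<Union>j. D j)" by blast
  qed
  then have "hausdorff_pre \<psi> \<delta> E \<le> (\<Sum>j. ennreal (\<psi> (diameter (D j))))"
    unfolding hausdorff_pre_def using C_small h_in_I \<open>\<delta> \<ge> 0\<close> by (intro INF_lower) (auto simp: D_def)
  also have "\<dots> = (\<Sum>j<card I. ennreal (\<psi> (diameter (D j))))"
    using gauge by (intro suminf_finite) (auto simp: D_def gauge_function_def)
  also have "\<dots> = (\<Sum>j<card I. ennreal (\<psi> (diameter (C (h j)))))"
    by (intro sum.cong) (auto simp: D_def)
  also have "\<dots> = (\<Sum>i\<in>I. ennreal (\<psi> (diameter (C i))))"
    by (rule sum.reindex_bij_betw[OF bij_h])
  finally show ?thesis .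
qed

definition words :: "nat \<Rightarrow> (nat \<Rightarrow> 'b) set" where
  "words k = PiE {..<k} (\<lambda>_. UNIV)"

lemma finite_words: "finite (words k :: (nat \<Rightarrow> 'b::finite) set)"
  by (simp add: words_def finite_PiE)

lemma card_words: "card (words k :: (nat \<Rightarrow> 'b::finite) set) = CARD('b) ^ k"
  by (simp add: words_def card_PiE)

lemma restrict_in_words: "restrict e {..<k} \<in> words k"
  by (simp add: words_def)

definition cylinder :: "nat \<Rightarrow> (nat \<Rightarrow> 'b) \<Rightarrow> (nat \<Rightarrow> 'b) set" where
  "cylinder k p = {e. \<forall>j<k. e j = p j}"

lemma UN_cylinder_words: "(\<Union>p\<in>words k. cylinder k p) = UNIV"
  using restrict_in_words by (fastforce simp: cylinder_def)

lemma words_inj_cylinder: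
  assumes "p \<in> words k" "p' \<in> words k" "p' \<in> cylinder k p"
  shows "p' = p"
  using assms unfolding words_def cylinder_def by (intro PiE_ext[of p' "{..<k}"]) auto

definition code_measure :: "(nat \<Rightarrow> 'b::finite) measure" where
  "code_measure = PiM UNIV (\<lambda>_. uniform_count_measure UNIV)"

lemma space_code_measure [simp]: "space code_measure = UNIV"
  by (simp add: code_measure_def space_PiM space_uniform_count_measure)

lemma prob_space_code_measure: "prob_space (code_measure :: (nat \<Rightarrow> 'b::finite) measure)"
  unfolding code_measure_def by (intro prob_space_PiM prob_space_uniform_count_measure) auto

lemma sets_cylinder [simp]: "cylinder k p \<in> sets (code_measure :: (nat \<Rightarrow> 'b::finite) measure)"
proof -
  have "{e \<in> space code_measure. \<forall>j\<in>{..<k}. e j \<in> {p j}} \<in> sets (code_measure :: (nat \<Rightarrow> 'b) measure)"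
    unfolding code_measure_def by measurable
  then show ?thesis by (simp add: cylinder_def Ball_def)
qed

lemma emeasure_cylinder:
  fixes p :: "nat \<Rightarrow> 'b::finite"
  shows "emeasure code_measure (cylinder k p) = ennreal ((1 / real CARD('b)) ^ k)"
proof -
  interpret digit: prob_space "uniform_count_measure (UNIV :: 'b set)"
    by (rule prob_space_uniform_count_measure) auto
  interpret product_prob_space "\<lambda>_::nat. uniform_count_measure (UNIV :: 'b set)" UNIV ..
  have "cylinder k p = {e \<in> space code_measure. \<forall>j\<in>{..<k}. e j \<in> {p j}}" by (auto simp: cylinder_def)
  also have "emeasure code_measure \<dots> = (\<Prod>j<k. emeasure (uniform_count_measure UNIV) {p j})"
    unfolding code_measure_def by (rule emeasure_PiM_Collect) (simp_all add: sets_uniform_count_measure)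
  also have "\<dots> = ennreal (1 / real CARD('b)) ^ k" by (simp add: emeasure_uniform_count_measure)
  finally show ?thesis by (simp add: ennreal_power)
qed

lemma emeasure_code_measure_singleton:
  fixes p :: "nat \<Rightarrow> 'b::finite"
  assumes "CARD('b) \<ge> 2"
  shows "{p} \<in> sets code_measure" "emeasure code_measure {p} = 0"
proof -
  have singleton_eq: "{p} = (\<Inter>k. cylinder k p)" by (auto simp: cylinder_def fun_eq_iff)
  show "{p} \<in> sets code_measure" unfolding singleton_eq by (intro sets.countable_INT sets_cylinder) auto
  have "(\<lambda>k. ennreal ((1 / real CARD('b)) ^ k)) \<longlonglongrightarrow> ennreal 0"
    using assms by (intro tendsto_ennrealI LIMSEQ_realpow_zero) auto
  moreover have "emeasure code_measure {p} \<le> ennreal ((1 / real CARD('b)) ^ k)" for k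
    unfolding emeasure_cylinder[of k p, symmetric] by (rule emeasure_mono) (simp add: cylinder_def, simp)
  ultimately have "emeasure code_measure {p} \<le> ennreal 0" by (intro LIMSEQ_le_const) auto
  then show "emeasure code_measure {p} = 0" by simp
qed

lemma tendsto_0_bracket:
  fixes s :: "nat \<Rightarrow> real"
  assumes "s \<longlonglongrightarrow> 0" "0 < d" "d < s k0"
  obtains k where "k0 \<le> k" "s (Suc k) \<le> d" "d < s k"
proof -
  obtain N where s_less: "\<And>k. k \<ge> N \<Longrightarrow> s k < d"
    using order_tendstoD(2)[OF assms(1,2)] unfolding eventually_sequentially by blast
  have "\<exists>j. s (k0 + j) \<le> d" using s_less[of "k0 + N"] by (intro exI[of _ N]) simp
  then obtain j where j_least: "s (k0 + j) \<le> d" "\<And>i. i < j \<Longrightarrow> \<not> s (k0 + i) \<le> d"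
    unfolding exists_least_iff[of "\<lambda>j. s (k0 + j) \<le> d"] by blast
  from j_least(1) assms(3) obtain i where "j = Suc i" by (cases j) auto
  then show ?thesis using that[of "k0 + i"] j_least by (auto simp: not_le)
qed

lemma code_measure_preimage_le:
  fixes z :: "(nat \<Rightarrow> 'b::finite) \<Rightarrow> 'a::euclidean_space"
  assumes gauge: "gauge_function \<psi>" and card: "CARD('b) \<ge> 2"
    and scale: "\<And>k. s k > 0" "s \<longlonglongrightarrow> 0"
    and separated: "\<And>e e' k. dist (z e) (z e') < s k \<Longrightarrow> e' \<in> cylinder (Suc k) e"
    and weight: "\<And>k. k \<ge> k0 \<Longrightarrow> K \<le> \<psi> (s k) * real CARD('b) ^ k"
    and C_small: "bounded C" "diameter C < s k0"
  obtains S where "S \<in> sets code_measure" "z -` C \<subseteq> S"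
    "ennreal K * emeasure code_measure S \<le> ennreal (\<psi> (diameter C))"
proof (cases "z -` C = {}")
  case True
  then show thesis using that[of "{}"] by simp
next
  case False
  then obtain p where p_in_C: "z p \<in> C" by blast
  have same_cylinder: "e \<in> cylinder (Suc k) p" if "z e \<in> C" "diameter C < s k" for e k
    using diameter_bounded_bound[OF C_small(1) p_in_C that(1)] that(2) by (intro separated) linarith
  consider (singleton) "diameter C = 0" | (positive) "diameter C > 0"
    using diameter_ge_0[OF C_small(1)] by linarith
  then show thesis
  proof cases
    case singleton
    have "e = p" if "z e \<in> C" for e
      using same_cylinder[OF that] scale(1) singleton by (auto simp: cylinder_def fun_eq_iff)
    then show thesis
      using emeasure_code_measure_singleton[OF card, of p] by (intro that[of "{p}"]) auto
  next
    case positive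
    from tendsto_0_bracket[OF scale(2) positive C_small(2)]
    obtain k where k_bracket: "k0 \<le> k" "s (Suc k) \<le> diameter C" "diameter C < s k" by blast
    have "K * (1 / real CARD('b)) ^ Suc k \<le> \<psi> (s (Suc k))"
      using weight[of "Suc k"] k_bracket(1) by (simp add: power_one_over field_simps)
    also have "\<dots> \<le> \<psi> (diameter C)"
      using k_bracket(2) scale(1) by (intro gauge_function_mono[OF gauge]) (simp add: less_imp_le)
    finally have "ennreal K * emeasure code_measure (cylinder (Suc k) p) \<le> ennreal (\<psi> (diameter C))"
      by (simp add: emeasure_cylinder ennreal_mult''[symmetric] ennreal_leI)
    moreover have "z -` C \<subseteq> cylinder (Suc k) p" using same_cylinder k_bracket(3) by blast
    ultimately show thesis by (intro that[OF sets_cylinder])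
  qed
qed

lemma hausdorff_gauge_ge_coded:
  fixes z :: "(nat \<Rightarrow> 'b::finite) \<Rightarrow> 'a::euclidean_space"
  assumes gauge: "gauge_function \<psi>" and card: "CARD('b) \<ge> 2"
    and scale: "\<And>k. s k > 0" "s \<longlonglongrightarrow> 0"
    and separated: "\<And>e e' k. dist (z e) (z e') < s k \<Longrightarrow> e' \<in> cylinder (Suc k) e"
    and weight: "\<forall>\<^sub>F k in sequentially. K \<le> \<psi> (s k) * real CARD('b) ^ k"
  shows "ennreal K \<le> hausdorff_gauge \<psi> (range z)"
proof -
  let ?M = "code_measure :: (nat \<Rightarrow> 'b) measure"
  obtain k0 where weight_ge: "\<And>k. k \<ge> k0 \<Longrightarrow> K \<le> \<psi> (s k) * real CARD('b) ^ k"
    using weight unfolding eventually_sequentially by blast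
  have "ennreal K * emeasure ?M (space ?M) \<le> hausdorff_gauge \<psi> (z ` space ?M)"
  proof (rule hausdorff_gauge_ge_mass)
    show "s k0 / 2 > 0" using scale(1) by simp
    fix C :: "'a set" assume C_small: "bounded C" "diameter C \<le> s k0 / 2"
    then have "diameter C < s k0" using scale(1)[of k0] by linarith
    from code_measure_preimage_le[OF gauge card scale separated weight_ge C_small(1) this]
    obtain S where "S \<in> sets ?M" "z -` C \<subseteq> S" "ennreal K * emeasure ?M S \<le> ennreal (\<psi> (diameter C))" .
    then show "\<exists>S\<in>sets ?M. z -` C \<inter> space ?M \<subseteq> S \<and> ennreal K * emeasure ?M S \<le> ennreal (\<psi> (diameter C))"
      by (intro bexI[of _ S]) auto
  qed
  moreover have "emeasure ?M (space ?M) = 1"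
    by (rule prob_space.emeasure_space_1[OF prob_space_code_measure])
  ultimately show ?thesis by simp
qed

lemma hausdorff_gauge_le_coded:
  fixes z :: "(nat \<Rightarrow> 'b::finite) \<Rightarrow> 'a::euclidean_space"
  assumes gauge: "gauge_function \<psi>" and scale: "\<And>k. t k \<ge> 0" "t \<longlonglongrightarrow> 0"
    and close: "\<And>e e' k. e' \<in> cylinder k e \<Longrightarrow> dist (z e) (z e') \<le> t k"
    and weight: "\<forall>\<^sub>F k in sequentially. \<psi> (t k) * real CARD('b) ^ k \<le> K"
  shows "hausdorff_gauge \<psi> (range z) \<le> ennreal K"
  unfolding hausdorff_gauge_def
proof (rule SUP_least)
  fix \<delta> :: real assume "\<delta> \<in> {0<..}"
  then have "\<forall>\<^sub>F k in sequentially. t k < \<delta>" using order_tendstoD(2)[OF scale(2)] by auto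
  from eventually_happens'[OF sequentially_bot eventually_conj[OF this weight]]
  obtain k where k_choice: "t k < \<delta>" "\<psi> (t k) * real CARD('b) ^ k \<le> K" by blast
  have close_in_cylinder: "dist x y \<le> t k" if "x \<in> z ` cylinder k p" "y \<in> z ` cylinder k p" for p x y
    using that by (auto simp: cylinder_def intro!: close)
  have diameter: "diameter (z ` cylinder k p) \<le> t k" for p
    using scale(1) close_in_cylinder by (intro diameter_le) (auto simp: dist_norm)
  have bounded: "bounded (z ` cylinder k p)" for p
    unfolding bounded_def using close_in_cylinder[of "z p" p]
    by (intro exI[of _ "z p"] exI[of _ "t k"]) (auto simp: cylinder_def)
  have "hausdorff_pre \<psi> \<delta> (range z) \<le> (\<Sum>p\<in>words k. ennreal (\<psi> (diameter (z ` cylinder k p))))"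
  proof (rule hausdorff_pre_le_finite_cover[OF gauge _ finite_words])
    show "range z \<subseteq> (\<Union>p\<in>words k. z ` cylinder k p)"
      by (simp only: image_UN[symmetric] UN_cylinder_words)
    show "diameter (z ` cylinder k p) \<le> \<delta>" for p using diameter[of p] k_choice(1) by linarith
  qed (use \<open>\<delta> \<in> _\<close> bounded in auto)
  also have "\<dots> \<le> (\<Sum>p\<in>(words k :: (nat \<Rightarrow> 'b) set). ennreal (\<psi> (t k)))"
    using diameter bounded diameter_ge_0 by (intro sum_mono ennreal_leI gauge_function_mono[OF gauge]) auto
  also have "\<dots> = ennreal (\<psi> (t k) * real CARD('b) ^ k)"
    using gauge_function_nonneg[OF gauge scale(1)]
    by (simp add: card_words ennreal_mult mult.commute ennreal_of_nat_eq_real_of_nat)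
  also have "\<dots> \<le> ennreal K" by (rule ennreal_leI) (rule k_choice)
  finally show "hausdorff_pre \<psi> \<delta> (range z) \<le> ennreal K" .
qed

lemma hausdorff_gauge_infinite_coded:
  fixes z :: "(nat \<Rightarrow> 'b::finite) \<Rightarrow> 'a::euclidean_space"
  assumes "gauge_function \<psi>" "CARD('b) \<ge> 2" "\<And>k. s k > 0" "s \<longlonglongrightarrow> 0"
    and "\<And>e e' k. dist (z e) (z e') < s k \<Longrightarrow> e' \<in> cylinder (Suc k) e"
    and weight: "filterlim (\<lambda>k. \<psi> (s k) * real CARD('b) ^ k) at_top sequentially"
  shows "hausdorff_gauge \<psi> (range z) = \<infinity>"
proof -
  have "of_nat N \<le> hausdorff_gauge \<psi> (range z)" for N
    using hausdorff_gauge_ge_coded[OF assms(1-5), where K = "real N"] weight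
    by (simp add: filterlim_at_top ennreal_of_nat_eq_real_of_nat)
  then have "(SUP N. of_nat N) \<le> hausdorff_gauge \<psi> (range z)" by (rule SUP_least)
  then show ?thesis by (simp add: ennreal_SUP_of_nat_eq_top top_unique infinity_ennreal_def)
qed

section \<open>Points coded by sequences of binary digit vectors\<close>

definition digit :: "bool^'n::finite \<Rightarrow> real^'n" where
  "digit b = (\<chi> i. of_bool (b $ i))"

lemma digit_nth [simp]: "digit b $ i = of_bool (b $ i)"
  by (simp add: digit_def)

lemma norm_vec_le_CARD:
  fixes v :: "real^'n::finite"
  assumes "\<And>i. \<bar>v $ i\<bar> \<le> 1"
  shows "norm v \<le> real CARD('n)"
  using norm_le_l1_cart[of v] sum_bounded_above[of UNIV "\<lambda>i. \<bar>v $ i\<bar>" 1] assms by simp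

lemma norm_digit_le: "norm (digit b :: real^'n::finite) \<le> real CARD('n)"
  by (rule norm_vec_le_CARD) simp

lemma norm_digit_diff_le: "norm (digit b - digit c :: real^'n::finite) \<le> real CARD('n)"
  by (rule norm_vec_le_CARD) auto

lemma card_bool_vec_ge_2: "CARD(bool^'n::finite) \<ge> 2"
  using power_increasing[of 1 "CARD('n)" "2::nat"] by (simp add: Suc_le_eq)

lemma continuous_on_digit_coordinate: "continuous_on UNIV (\<lambda>e :: nat \<Rightarrow> bool^'n::finite. digit (e k))"
proof -
  have "continuous_on UNIV (\<lambda>e :: nat \<Rightarrow> bool^'n. of_bool (e k $ i) :: real)" for i
  proof (rule continuous_on_compose2[where f = "\<lambda>e. e k $ i" and t = UNIV])
    show "continuous_on UNIV (\<lambda>e :: nat \<Rightarrow> bool^'n. e k $ i)"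
      using continuous_on_product_coordinates[where i = k]
      by (auto simp: continuous_on_def intro: tendsto_vec_nth)
  qed simp_all
  then show ?thesis by (auto simp: digit_def continuous_on_def intro!: tendsto_vec_lambda)
qed

lemma compact_UNIV_codes: "compact (UNIV :: (nat \<Rightarrow> bool^'n::finite) set)"
proof -
  have "compact_space (euclidean :: (bool^'n) topology)"
    by (simp add: compact_space_def finite_imp_compact)
  then have "compact_space (product_topology (\<lambda>_::nat. euclidean :: (bool^'n) topology) UNIV)"
    by (simp add: compact_space_product_topology)
  then show ?thesis by (simp add: euclidean_product_topology compact_space_def)
qed

lemma continuous_on_suminf:
  fixes f :: "nat \<Rightarrow> 'a::topological_space \<Rightarrow> 'b::banach"
  assumes "\<And>k. continuous_on S (f k)" "\<And>k x. x \<in> S \<Longrightarrow> norm (f k x) \<le> b k" "summable b"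
  shows "continuous_on S (\<lambda>x. \<Sum>k. f k x)"
proof (rule uniform_limit_theorem)
  show "uniform_limit S (\<lambda>N x. \<Sum>k<N. f k x) (\<lambda>x. \<Sum>k. f k x) sequentially"
    by (rule Weierstrass_m_test[OF assms(2,3)])
  show "\<forall>\<^sub>F N in sequentially. continuous_on S (\<lambda>x. \<Sum>k<N. f k x)"
    by (intro always_eventually allI continuous_intros assms(1))
qed simp

definition code_point :: "(nat \<Rightarrow> real) \<Rightarrow> (nat \<Rightarrow> bool^'n::finite) \<Rightarrow> real^'n" where
  "code_point s e = (\<Sum>k. s k *\<^sub>R digit (e k))"

locale decaying_weights =
  fixes s :: "nat \<Rightarrow> real" and x :: real
  assumes s_pos: "s k > 0" and s_Suc: "s (Suc k) \<le> x * s k" and ratio: "0 < x" "x < 1/2"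
begin

lemma s_add_le: "s (i + k) \<le> x ^ i * s k"
proof (induction i)
  case (Suc i)
  have "s (Suc i + k) \<le> x * s (i + k)" using s_Suc[of "i + k"] by simp
  also have "\<dots> \<le> x * (x ^ i * s k)" using Suc ratio by (intro mult_left_mono) auto
  finally show ?case by (simp add: mult_ac)
qed simp

lemma s_antimono:
  assumes "j \<le> k"
  shows "s k \<le> s j"
proof -
  have "s k \<le> x ^ (k - j) * s j" using s_add_le[of "k - j" j] assms by simp
  also have "\<dots> \<le> 1 * s j" using ratio s_pos[of j] by (intro mult_right_mono power_le_one) auto
  finally show ?thesis by simp
qed

lemma summable_s: "summable s"
proof (rule summable_comparison_test')
  show "summable (\<lambda>k. x ^ k * s 0)" using ratio by (intro summable_mult2 summable_geometric) simp
  show "norm (s k) \<le> x ^ k * s 0" for k using s_add_le[of k 0] s_pos[of k] by simp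
qed

lemma s_tendsto_0: "s \<longlonglongrightarrow> 0"
  by (rule summable_LIMSEQ_zero[OF summable_s])

lemma filterlim_scaled_at_right_0:
  assumes "a > 0"
  shows "filterlim (\<lambda>k. a * s k) (at_right 0) sequentially"
  using assms s_pos tendsto_mult_right_zero[OF s_tendsto_0, of a]
  by (auto intro!: tendsto_imp_filterlim_at_right always_eventually)

lemma suminf_tail_le: "(\<Sum>i. s (i + k)) \<le> s k / (1 - x)"
proof -
  have "norm x < 1" using ratio by simp
  from sums_mult2[OF geometric_sums[OF this], of "s k"]
  have "(\<lambda>i. x ^ i * s k) sums (s k / (1 - x))" by simp
  then show ?thesis
    by (rule sums_le[OF s_add_le summable_sums[OF summable_ignore_initial_segment[OF summable_s]]])
qed

lemma summable_scaleR_bounded: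
  fixes v :: "nat \<Rightarrow> 'a::banach"
  assumes "\<And>i. norm (v i) \<le> B"
  shows "summable (\<lambda>i. s i *\<^sub>R v i)"
proof (rule summable_comparison_test')
  show "summable (\<lambda>i. s i * B)" using summable_s by (rule summable_mult2)
  show "norm (s i *\<^sub>R v i) \<le> s i * B" for i using s_pos[of i] assms[of i] by simp
qed

lemma norm_suminf_scaleR_le:
  fixes v :: "nat \<Rightarrow> 'a::banach"
  assumes "\<And>i. norm (v i) \<le> B" and "\<And>i. i < k \<Longrightarrow> v i = 0"
  shows "norm (\<Sum>i. s i *\<^sub>R v i) \<le> B * s k / (1 - x)"
proof -
  have "(\<Sum>i. s i *\<^sub>R v i) = (\<Sum>i. s (i + k) *\<^sub>R v (i + k))"
    using suminf_split_initial_segment[OF summable_scaleR_bounded[OF assms(1)], where k = k] assms(2) by simp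
  also have "norm \<dots> \<le> (\<Sum>i. s (i + k) * B)"
  proof (rule norm_suminf_le)
    show "norm (s (i + k) *\<^sub>R v (i + k)) \<le> s (i + k) * B" for i
      using s_pos[of "i + k"] assms(1)[of "i + k"] by simp
    show "summable (\<lambda>i. s (i + k) * B)"
      using summable_s by (intro summable_mult2) (rule summable_ignore_initial_segment)
  qed
  also have "\<dots> = (\<Sum>i. s (i + k)) * B"
    using summable_ignore_initial_segment[OF summable_s, of k] by (rule suminf_mult2[symmetric])
  also have "\<dots> \<le> s k / (1 - x) * B"
    using suminf_tail_le order_trans[OF norm_ge_zero assms(1)] by (rule mult_right_mono)
  finally show ?thesis by (simp add: mult.commute)
qed

definition gap :: real where "gap = (1 - 2 * x) / (1 - x)"

lemma gap_pos: "gap > 0"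
  unfolding gap_def using ratio by (intro divide_pos_pos) linarith+

lemma abs_suminf_ge_gap:
  fixes D :: "nat \<Rightarrow> real"
  assumes D_first: "\<And>i. \<bar>D i\<bar> \<le> 1" "\<And>i. i < k \<Longrightarrow> D i = 0" "\<bar>D k\<bar> = 1"
  shows "gap * s k \<le> \<bar>\<Sum>i. s i * D i\<bar>"
proof -
  define T where "T i = (if i = k then 0 else D i)" for i
  have "(\<lambda>i. (if i = k then s k * D k else 0) + s i * T i) sums (s k * D k + (\<Sum>i. s i * T i))"
    using summable_scaleR_bounded[of T 1] D_first(1)
    by (intro sums_add sums_single summable_sums) (simp add: T_def)
  moreover have "(if i = k then s k * D k else 0) + s i * T i = s i * D i" for i by (simp add: T_def)
  ultimately have first_term: "(\<Sum>i. s i * D i) = s k * D k + (\<Sum>i. s i * T i)" by (simp add: sums_iff)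
  have "\<bar>\<Sum>i. s i * T i\<bar> \<le> s (Suc k) / (1 - x)"
    using norm_suminf_scaleR_le[where v = T and B = 1 and k = "Suc k"] D_first
    by (fastforce simp: T_def less_Suc_eq)
  also have "\<dots> \<le> x * s k / (1 - x)" using s_Suc[of k] ratio by (intro divide_right_mono) auto
  finally have "\<bar>\<Sum>i. s i * T i\<bar> \<le> x * s k / (1 - x)" .
  moreover have "gap * s k = s k - x * s k / (1 - x)" using ratio by (simp add: gap_def field_simps)
  moreover have "s k = \<bar>s k * D k\<bar>" using D_first(3) s_pos[of k] by (simp add: abs_mult)
  moreover have "\<bar>s k * D k\<bar> - \<bar>\<Sum>i. s i * T i\<bar> \<le> \<bar>\<Sum>i. s i * D i\<bar>" unfolding first_term by linarith
  ultimately show ?thesis by linarith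
qed

lemma summable_code: "summable (\<lambda>k. s k *\<^sub>R digit (e k :: bool^'n::finite))"
  by (rule summable_scaleR_bounded[OF norm_digit_le])

lemma code_point_diff:
  "code_point s e - code_point s e' = (\<Sum>k. s k *\<^sub>R (digit (e k) - digit (e' k :: bool^'n::finite)))"
  by (simp add: code_point_def suminf_diff[OF summable_code summable_code] scaleR_diff_right)

lemma code_point_diff_nth:
  "(code_point s e - code_point s e') $ c = (\<Sum>k. s k * (digit (e k) - digit (e' k :: bool^'n::finite)) $ c)"
  unfolding code_point_diff
  using bounded_linear.suminf[OF bounded_linear_vec_nth[of c] summable_scaleR_bounded[OF norm_digit_diff_le]]
  by simp

lemma s_divide_one_minus_le: "s k / (1 - x) \<le> 2 * s k"
proof -
  have "s k * 1 \<le> s k * (2 * (1 - x))" using ratio s_pos[of k] by (intro mult_left_mono) auto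
  then show ?thesis using ratio by (simp add: pos_divide_le_eq mult_ac)
qed

lemma dist_code_point_le:
  fixes e e' :: "nat \<Rightarrow> bool^'n::finite"
  assumes "e' \<in> cylinder k e"
  shows "dist (code_point s e) (code_point s e') \<le> 2 * real CARD('n) * s k"
proof -
  have "dist (code_point s e) (code_point s e') \<le> real CARD('n) * (s k / (1 - x))"
    using norm_suminf_scaleR_le[of "\<lambda>i. digit (e i) - digit (e' i)", OF norm_digit_diff_le] assms
    by (simp add: dist_norm code_point_diff cylinder_def)
  also have "\<dots> \<le> real CARD('n) * (2 * s k)" by (intro mult_left_mono s_divide_one_minus_le) simp
  finally show ?thesis by (simp add: mult_ac)
qed

lemma dist_code_point_ge:
  fixes e e' :: "nat \<Rightarrow> bool^'n::finite"
  assumes "e' \<notin> cylinder (Suc k) e"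
  shows "gap * s k \<le> dist (code_point s e) (code_point s e')"
proof -
  obtain j where "j \<le> k" "e j \<noteq> e' j" using assms by (auto simp: cylinder_def less_Suc_eq_le)
  then obtain l where l_first: "l \<le> k" "e l \<noteq> e' l" "\<And>i. i < l \<Longrightarrow> e i = e' i"
    using exists_least_iff[of "\<lambda>l. e l \<noteq> e' l"] by (metis linorder_not_le order_trans)
  then obtain c where c_differs: "e l $ c \<noteq> e' l $ c" by (auto simp: vec_eq_iff)
  have "gap * s k \<le> gap * s l" using gap_pos s_antimono[OF l_first(1)] by (intro mult_left_mono) auto
  also have "\<dots> \<le> \<bar>\<Sum>i. s i * (digit (e i) - digit (e' i)) $ c\<bar>"
    using c_differs l_first(3) by (intro abs_suminf_ge_gap) auto
  also have "\<dots> \<le> dist (code_point s e) (code_point s e')"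
    unfolding code_point_diff_nth[symmetric] dist_norm by (rule component_le_norm_cart)
  finally show ?thesis .
qed

lemma code_point_separated:
  fixes e e' :: "nat \<Rightarrow> bool^'n::finite"
  assumes "dist (code_point s e) (code_point s e') < gap * s k"
  shows "e' \<in> cylinder (Suc k) e"
  using dist_code_point_ge[of e' k e] assms by force

lemma continuous_on_code_point:
  "continuous_on UNIV (code_point s :: (nat \<Rightarrow> bool^'n::finite) \<Rightarrow> real^'n)"
  unfolding code_point_def
proof (rule continuous_on_suminf)
  show "continuous_on UNIV (\<lambda>e :: nat \<Rightarrow> bool^'n. s k *\<^sub>R digit (e k))" for k
    by (intro continuous_intros continuous_on_digit_coordinate)
  show "norm (s k *\<^sub>R digit (e k)) \<le> s k * real CARD('n)" for k and e :: "nat \<Rightarrow> bool^'n"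
    using s_pos[of k] norm_digit_le[of "e k"] by simp
  show "summable (\<lambda>k. s k * real CARD('n))" using summable_s by (rule summable_mult2)
qed

lemma compact_range_code_point: "compact (range (code_point s :: (nat \<Rightarrow> bool^'n::finite) \<Rightarrow> real^'n))"
  by (rule compact_continuous_image[OF continuous_on_code_point compact_UNIV_codes])

end

section \<open>Integration by parts\<close>

definition continuous_compact_support :: "('a::euclidean_space \<Rightarrow> real) \<Rightarrow> bool" where
  "continuous_compact_support f \<longleftrightarrow> continuous_on UNIV f \<and> bounded {x. f x \<noteq> 0}"

lemma continuous_compact_supportE:
  assumes "continuous_compact_support f"
  obtains R where "\<And>x. norm x > R \<Longrightarrow> f x = 0"
  using assms unfolding continuous_compact_support_def bounded_iff by (metis mem_Collect_eq not_le)

lemma continuous_compact_support_times: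
  assumes "continuous_on UNIV g" "continuous_compact_support f"
  shows "continuous_compact_support (\<lambda>x. g x * f x)"
  using assms unfolding continuous_compact_support_def
  by (auto intro: continuous_on_mult bounded_subset)

lemma continuous_compact_support_bounded:
  assumes "continuous_compact_support f"
  obtains B where "\<And>x. \<bar>f x\<bar> \<le> B"
proof -
  obtain R where support: "\<And>x. norm x > R \<Longrightarrow> f x = 0"
    using continuous_compact_supportE[OF assms] by blast
  have "compact (f ` cball 0 R)"
    using assms by (intro compact_continuous_image)
      (auto simp: continuous_compact_support_def intro: continuous_on_subset)
  then obtain B where bound_on_ball: "\<And>x. norm x \<le> R \<Longrightarrow> \<bar>f x\<bar> \<le> B"
    using compact_imp_bounded bounded_iff by (metis imageI mem_cball_0 real_norm_def)
  have "\<bar>f x\<bar> \<le> max 0 B" for x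
    using support[of x] bound_on_ball[of x] by (cases "norm x \<le> R") auto
  then show thesis by (rule that)
qed

lemma integrable_continuous_compact_support:
  assumes "continuous_compact_support f"
  shows "integrable lborel f"
proof -
  obtain R where support: "\<And>x. norm x > R \<Longrightarrow> f x = 0"
    using continuous_compact_supportE[OF assms] by blast
  have "integrable lborel (\<lambda>x. indicator (cball 0 R) x *\<^sub>R f x)"
    using assms by (intro borel_integrable_compact)
      (auto simp: continuous_compact_support_def intro: continuous_on_subset)
  moreover have "indicator (cball 0 R) x *\<^sub>R f x = f x" for x
    using support[of x] by (cases "x \<in> cball 0 R") auto
  ultimately show ?thesis by (simp only:)
qed

lemma lborel_integral_translate:
  fixes f :: "'a::euclidean_space \<Rightarrow> 'b::{banach, second_countable_topology}"
  assumes "integrable lborel f"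
  shows "integrable lborel (\<lambda>x. f (x + a))" "(\<integral>x. f (x + a) \<partial>lborel) = (\<integral>x. f x \<partial>lborel)"
proof -
  have [measurable]: "f \<in> borel_measurable borel" using assms by auto
  have "integrable (distr lborel borel ((+) a)) f" using assms by (simp add: lborel_distr_plus)
  then show "integrable lborel (\<lambda>x. f (x + a))" by (simp add: integrable_distr_eq add.commute)
  have "(\<integral>x. f x \<partial>distr lborel borel ((+) a)) = (\<integral>x. f (x + a) \<partial>lborel)"
    by (subst integral_distr) (simp_all add: add.commute)
  then show "(\<integral>x. f (x + a) \<partial>lborel) = (\<integral>x. f x \<partial>lborel)" by (simp add: lborel_distr_plus)
qed

lemma directional_difference_le:
  fixes f D :: "'a::real_normed_vector \<Rightarrow> real"
  assumes deriv: "\<And>x. ((\<lambda>t. f (x + t *\<^sub>R a)) has_real_derivative D x) (at 0)"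
    and D_bound: "\<And>x. \<bar>D x\<bar> \<le> B" and "h > 0"
  shows "\<bar>f (x + h *\<^sub>R a) - f x\<bar> \<le> B * h"
proof -
  have "((\<lambda>t. f (x + t *\<^sub>R a)) has_real_derivative D (x + t *\<^sub>R a)) (at t)" for t
    using deriv[of "x + t *\<^sub>R a"] DERIV_shift[of "\<lambda>t. f (x + t *\<^sub>R a)" "D (x + t *\<^sub>R a)" 0 t]
    by (simp add: scaleR_add_left add_ac)
  then obtain z where "f (x + h *\<^sub>R a) - f x = h * D (x + z *\<^sub>R a)"
    using MVT2[of 0 h "\<lambda>t. f (x + t *\<^sub>R a)" "\<lambda>t. D (x + t *\<^sub>R a)"] \<open>h > 0\<close> by auto
  then show ?thesis using D_bound[of "x + z *\<^sub>R a"] \<open>h > 0\<close> by (simp add: abs_mult mult.commute)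
qed

lemma directional_difference_le_indicator:
  fixes f D :: "'a::real_normed_vector \<Rightarrow> real"
  assumes deriv: "\<And>x. ((\<lambda>t. f (x + t *\<^sub>R a)) has_real_derivative D x) (at 0)"
    and D_bound: "\<And>x. \<bar>D x\<bar> \<le> B" and support: "\<And>x. norm x > R \<Longrightarrow> f x = 0" and h_range: "0 < h" "h \<le> 1"
  shows "\<bar>(f (x + h *\<^sub>R a) - f x) / h\<bar> \<le> B * indicator (cball 0 (R + norm a)) x"
proof (cases "x \<in> cball 0 (R + norm a)")
  case True
  then show ?thesis
    using directional_difference_le[OF deriv D_bound h_range(1), of x] h_range(1) by (simp add: pos_divide_le_eq)
next
  case False
  then have "norm x > R + norm a" by simp
  moreover have "norm (h *\<^sub>R a) \<le> norm a" using h_range by (simp add: mult_left_le_one_le)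
  ultimately have "norm (x + h *\<^sub>R a) > R" "norm x > R"
    using norm_diff_ineq[of x "h *\<^sub>R a"] norm_ge_zero[of a] by linarith+
  then show ?thesis using False support by simp
qed

lemma integral_directional_derivative_eq_0:
  fixes f D :: "'a::euclidean_space \<Rightarrow> real"
  assumes compact_support: "continuous_compact_support f"
    and deriv: "\<And>x. ((\<lambda>t. f (x + t *\<^sub>R a)) has_real_derivative D x) (at 0)"
    and D_bound: "\<And>x. \<bar>D x\<bar> \<le> B"
  shows "integrable lborel D" "(\<integral>x. D x \<partial>lborel) = 0"
proof -
  define h where "h N = inverse (real (Suc N))" for N
  define quotient where "quotient N x = (f (x + h N *\<^sub>R a) - f x) / h N" for N x
  have h_range: "h N > 0" "h N \<le> 1" for N by (auto simp: h_def inverse_le_1_iff)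
  have int_f: "integrable lborel f" using compact_support by (rule integrable_continuous_compact_support)
  then have [measurable]: "f \<in> borel_measurable borel" by auto
  obtain R where support: "\<And>x. norm x > R \<Longrightarrow> f x = 0"
    using continuous_compact_supportE[OF compact_support] by blast
  let ?bound = "\<lambda>x::'a. B * indicator (cball 0 (R + norm a)) x"
  have limit: "(\<lambda>N. quotient N x) \<longlonglongrightarrow> D x" for x
  proof -
    have "h \<longlonglongrightarrow> 0" unfolding h_def by (rule LIMSEQ_inverse_real_of_nat)
    then have "filterlim h (at 0) sequentially"
      unfolding filterlim_at using h_range(1) by (auto simp: less_imp_neq[symmetric] intro!: always_eventually)
    moreover have "((\<lambda>t. (f (x + t *\<^sub>R a) - f x) / t) \<longlongrightarrow> D x) (at 0)"
      using DERIV_D[OF deriv[of x]] by simp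
    ultimately show ?thesis unfolding quotient_def by (rule filterlim_compose[rotated])
  qed
  then have AE_limit: "AE x in lborel. (\<lambda>N. quotient N x) \<longlonglongrightarrow> D x" by simp
  have AE_bound: "AE x in lborel. norm (quotient N x) \<le> ?bound x" for N
    using directional_difference_le_indicator[OF deriv D_bound support h_range] by (simp add: quotient_def)
  have meas_quotient: "quotient N \<in> borel_measurable lborel" for N
    unfolding quotient_def by measurable
  have meas_D: "D \<in> borel_measurable lborel"
    by (rule borel_measurable_LIMSEQ_metric[OF meas_quotient limit])
  have int_bound: "integrable lborel ?bound"
    using emeasure_lborel_cball_finite[of "0::'a"]
    by (intro integrable_mult_right) (simp add: integrable_indicator_iff)
  show "integrable lborel D"
    by (rule integrable_dominated_convergence[OF meas_D meas_quotient int_bound AE_limit AE_bound])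
  have "(\<lambda>N. \<integral>x. quotient N x \<partial>lborel) \<longlonglongrightarrow> (\<integral>x. D x \<partial>lborel)"
    by (rule integral_dominated_convergence[OF meas_D meas_quotient int_bound AE_limit AE_bound])
  moreover have "(\<integral>x. quotient N x \<partial>lborel) = 0" for N
    using lborel_integral_translate[OF int_f, of "h N *\<^sub>R a"] int_f by (simp add: quotient_def)
  ultimately show "(\<integral>x. D x \<partial>lborel) = 0" by (simp add: LIMSEQ_const_iff)
qed

lemma integral_by_parts_directional:
  fixes w w' \<psi> \<psi>' :: "'a::euclidean_space \<Rightarrow> real"
  assumes w_bounds: "continuous_on UNIV w" "\<And>x. \<bar>w' x\<bar> \<le> B"
    and compact_support: "continuous_compact_support \<psi>" "continuous_compact_support \<psi>'"
    and deriv: "\<And>x. ((\<lambda>t. w (x + t *\<^sub>R a)) has_real_derivative w' x) (at 0)"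
      "\<And>x. ((\<lambda>t. \<psi> (x + t *\<^sub>R a)) has_real_derivative \<psi>' x) (at 0)"
  shows "(\<integral>x. w x * \<psi>' x \<partial>lborel) = - (\<integral>x. w' x * \<psi> x \<partial>lborel)"
proof -
  note w\<psi>' = continuous_compact_support_times[OF w_bounds(1) compact_support(2)]
  obtain B\<psi> where \<psi>_bound: "\<And>x. \<bar>\<psi> x\<bar> \<le> B\<psi>"
    using continuous_compact_support_bounded[OF compact_support(1)] by blast
  obtain Bw where w\<psi>'_bound: "\<And>x. \<bar>w x * \<psi>' x\<bar> \<le> Bw"
    using continuous_compact_support_bounded[OF w\<psi>'] by blast
  have product_deriv: "((\<lambda>t. w (x + t *\<^sub>R a) * \<psi> (x + t *\<^sub>R a))
      has_real_derivative w' x * \<psi> x + w x * \<psi>' x) (at 0)" for x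
    using DERIV_mult[OF deriv] by (simp add: mult.commute)
  have product_bound: "\<bar>w' x * \<psi> x + w x * \<psi>' x\<bar> \<le> B * B\<psi> + Bw" for x
    using mult_mono[OF w_bounds(2)[of x] \<psi>_bound[of x]] w\<psi>'_bound[of x]
      order_trans[OF abs_ge_zero w_bounds(2)[of x]]
      abs_triangle_ineq[of "w' x * \<psi> x" "w x * \<psi>' x"] by (simp add: abs_mult)
  note product_integral = integral_directional_derivative_eq_0
    [OF continuous_compact_support_times[OF w_bounds(1) compact_support(1)] product_deriv product_bound]
  have int_w\<psi>': "integrable lborel (\<lambda>x. w x * \<psi>' x)"
    by (rule integrable_continuous_compact_support[OF w\<psi>'])
  have "integrable lborel (\<lambda>x. w' x * \<psi> x)"
    using Bochner_Integration.integrable_diff[OF product_integral(1) int_w\<psi>'] by simp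
  then show ?thesis using product_integral(2) int_w\<psi>' by simp
qed

lemma has_derivative_imp_directional:
  assumes "(f has_derivative f') (at x)"
  shows "((\<lambda>t. f (x + t *\<^sub>R a)) has_real_derivative f' a) (at 0)"
proof -
  have "((\<lambda>t. x + t *\<^sub>R a) has_derivative (\<lambda>t. t *\<^sub>R a)) (at (0::real))"
    by (auto intro!: derivative_eq_intros)
  then have "((\<lambda>t. f (x + t *\<^sub>R a)) has_derivative (\<lambda>t. f' (t *\<^sub>R a))) (at 0)"
    by (rule has_derivative_compose) (simp add: assms)
  moreover have "f' (t *\<^sub>R a) = f' a * t" for t
    using linear_cmul[OF has_derivative_linear[OF assms]] by (simp add: mult.commute)
  ultimately show ?thesis by (simp add: has_field_derivative_def mult_commute_abs)
qed

lemma test_function_directional_derivative: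
  assumes "test_function \<psi>"
  shows "((\<lambda>t. \<psi> (x + t *\<^sub>R axis j 1)) has_real_derivative partial_deriv j \<psi> x) (at 0)"
proof -
  have "Ck 1 \<psi>" using assms by (simp add: test_function_def)
  then have "(\<psi> has_derivative frechet_derivative \<psi> (at x)) (at x)"
    by (simp add: frechet_derivative_works[symmetric])
  then show ?thesis unfolding partial_deriv_def by (rule has_derivative_imp_directional)
qed

lemma test_function_continuous_compact_support:
  assumes "test_function \<psi>"
  shows "continuous_compact_support \<psi>" "continuous_compact_support (partial_deriv j \<psi>)"
proof -
  let ?S = "closure {x. \<psi> x \<noteq> 0}"
  have "Ck 1 \<psi>" and "compact ?S" using assms by (auto simp: test_function_def)
  have "partial_deriv j \<psi> x = 0" if "x \<notin> ?S" for x
  proof -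
    have "(\<psi> has_derivative (\<lambda>_. 0)) (at x)"
      by (rule has_derivative_transform_within_open[OF has_derivative_const, of "- ?S" x 0])
        (use that closure_subset[of "{x. \<psi> x \<noteq> 0}"] in auto)
    then show ?thesis by (simp add: partial_deriv_def frechet_derivative_at[symmetric])
  qed
  then have "{x. partial_deriv j \<psi> x \<noteq> 0} \<subseteq> ?S" by blast
  then show "continuous_compact_support \<psi>" "continuous_compact_support (partial_deriv j \<psi>)"
    using \<open>Ck 1 \<psi>\<close> bounded_subset[OF compact_imp_bounded[OF \<open>compact ?S\<close>]] closure_subset
    by (auto simp: continuous_compact_support_def)
qed

section \<open>Logarithmic cutoff functions\<close>

lemma DERIV_max_0_power2: "((\<lambda>t. (max 0 t)\<^sup>2) has_real_derivative 2 * max 0 t) (at (t::real))"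
proof -
  consider (neg) "t < 0" | (zero) "t = 0" | (pos) "t > 0" by linarith
  then show ?thesis
  proof cases
    case neg
    have "((\<lambda>_. 0) has_real_derivative 0) (at t)" by simp
    then have "((\<lambda>t. (max 0 t)\<^sup>2) has_real_derivative 0) (at t)"
      by (rule has_field_derivative_transform_within_open[of _ _ _ "{..<0}"]) (use neg in auto)
    then show ?thesis using neg by simp
  next
    case zero
    have "((\<lambda>h. max 0 h) \<longlongrightarrow> max 0 0) (at (0::real))" by (intro tendsto_intros)
    moreover have "(max 0 h)\<^sup>2 / h = max 0 h" for h :: real by (simp add: max_def power2_eq_square)
    ultimately show ?thesis using zero by (simp add: DERIV_def)
  next
    case pos
    have "((\<lambda>t. t\<^sup>2) has_real_derivative 2 * t) (at t)" by (auto intro!: derivative_eq_intros)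
    then have "((\<lambda>t. (max 0 t)\<^sup>2) has_real_derivative 2 * t) (at t)"
      by (rule has_field_derivative_transform_within_open[of _ _ _ "{0<..}"]) (use pos in auto)
    then show ?thesis using pos by simp
  qed
qed

definition smooth_step :: "real \<Rightarrow> real" where
  "smooth_step t = 2 * ((max 0 t)\<^sup>2 - 2 * (max 0 (t - 1/2))\<^sup>2 + (max 0 (t - 1))\<^sup>2)"

definition smooth_step' :: "real \<Rightarrow> real" where
  "smooth_step' t = 4 * (max 0 t - 2 * max 0 (t - 1/2) + max 0 (t - 1))"

lemma DERIV_smooth_step: "(smooth_step has_real_derivative smooth_step' t) (at t)"
proof -
  have "((\<lambda>t. (max 0 (t - c))\<^sup>2) has_real_derivative 2 * max 0 (t - c)) (at t)" for c
    using DERIV_shift[of "\<lambda>t. (max 0 t)\<^sup>2" "2 * max 0 (t - c)" t "- c"] DERIV_max_0_power2[of "t - c"] by simp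
  note shifted = this this[of 0, simplified]
  show ?thesis
    unfolding smooth_step_def[abs_def] smooth_step'_def
    by (rule derivative_eq_intros shifted refl)+ simp
qed

lemma smooth_step'_nonneg: "0 \<le> smooth_step' t" and smooth_step'_le_2: "smooth_step' t \<le> 2"
  by (auto simp: smooth_step'_def max_def)

lemma smooth_step'_eq_0: "t \<le> 0 \<or> t \<ge> 1 \<Longrightarrow> smooth_step' t = 0"
  by (auto simp: smooth_step'_def max_def)

lemma smooth_step_eq_0: "t \<le> 0 \<Longrightarrow> smooth_step t = 0"
  by (simp add: smooth_step_def max_def)

lemma smooth_step_eq_1: "t \<ge> 1 \<Longrightarrow> smooth_step t = 1"
  by (simp add: smooth_step_def max_def power2_eq_square algebra_simps)

lemma smooth_step_mono:
  assumes "s \<le> t"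
  shows "smooth_step s \<le> smooth_step t"
proof (rule DERIV_nonneg_imp_nondecreasing[OF assms])
  show "\<exists>y. (smooth_step has_real_derivative y) (at x) \<and> 0 \<le> y" for x
    using DERIV_smooth_step smooth_step'_nonneg by blast
qed

lemma smooth_step_nonneg: "0 \<le> smooth_step t"
  using smooth_step_mono[of "min t 0" t] smooth_step_eq_0[of "min t 0"] by simp

lemma smooth_step_le_1: "smooth_step t \<le> 1"
  using smooth_step_mono[of t "max t 1"] smooth_step_eq_1[of "max t 1"] by simp

definition log_depth :: "real \<Rightarrow> real \<Rightarrow> 'a::real_normed_vector \<Rightarrow> real" where
  "log_depth l d y = (- ln (norm y) - l) / d"

lemma log_depth_le_0_iff:
  assumes "d > 0" "y \<noteq> 0"
  shows "log_depth l d y \<le> 0 \<longleftrightarrow> exp (- l) \<le> norm y"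
  using assms ln_ge_iff[of "norm y" "- l"] by (auto simp: log_depth_def divide_le_0_iff)

lemma log_depth_ge_1_iff:
  assumes "d > 0" "y \<noteq> 0"
  shows "1 \<le> log_depth l d y \<longleftrightarrow> norm y \<le> exp (- (l + d))"
proof -
  have "1 \<le> log_depth l d y \<longleftrightarrow> ln (norm y) \<le> - (l + d)"
    using assms(1) by (auto simp: log_depth_def pos_le_divide_eq)
  also have "\<dots> \<longleftrightarrow> norm y \<le> exp (- (l + d))"
    using assms(2) by (metis exp_le_cancel_iff exp_ln zero_less_norm_iff)
  finally show ?thesis .
qed

definition log_bump :: "real \<Rightarrow> real \<Rightarrow> 'a::real_normed_vector \<Rightarrow> real" where
  "log_bump l d y = (if y = 0 then 1 else smooth_step (log_depth l d y))"

definition log_bump_grad :: "real \<Rightarrow> real \<Rightarrow> 'a::real_normed_vector \<Rightarrow> 'a" where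
  "log_bump_grad l d y = (- smooth_step' (log_depth l d y) / (d * (norm y)\<^sup>2)) *\<^sub>R y"

lemma log_bump_bounds: "0 \<le> log_bump l d y" "log_bump l d y \<le> 1"
  using smooth_step_nonneg smooth_step_le_1 by (auto simp: log_bump_def)

lemma log_bump_eq_0:
  assumes "d > 0" "exp (- l) \<le> norm y"
  shows "log_bump l d y = 0"
proof -
  have "y \<noteq> 0" using assms(2) exp_gt_zero[of "- l"] by auto
  then show ?thesis using assms by (simp add: log_bump_def smooth_step_eq_0 log_depth_le_0_iff)
qed

lemma log_bump_eq_1:
  assumes "d > 0" "norm y \<le> exp (- (l + d))"
  shows "log_bump l d y = 1"
  using assms by (auto simp: log_bump_def smooth_step_eq_1 log_depth_ge_1_iff)

lemma log_bump_grad_eq_0: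
  assumes "d > 0" "exp (- l) \<le> norm y \<or> norm y \<le> exp (- (l + d))"
  shows "log_bump_grad l d y = 0"
  using assms log_depth_le_0_iff[of d y l] log_depth_ge_1_iff[of d y l]
  by (cases "y = 0") (auto simp: log_bump_grad_def smooth_step'_eq_0)

lemma norm_log_bump_grad_le:
  assumes "d > 0"
  shows "norm (log_bump_grad l d y) \<le> 2 / d / norm y"
proof (cases "y = 0")
  case False
  have "norm (log_bump_grad l d y) = smooth_step' (log_depth l d y) / d / norm y"
    using assms False smooth_step'_nonneg[of "log_depth l d y"]
    by (simp add: log_bump_grad_def abs_mult power2_eq_square)
  also have "\<dots> \<le> 2 / d / norm y"
    using assms smooth_step'_le_2 by (intro divide_right_mono) auto
  finally show ?thesis .
qed (simp add: log_bump_grad_def)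

lemma norm_log_bump_grad_le_exp:
  assumes "d > 0"
  shows "norm (log_bump_grad l d y) \<le> 2 / d * exp (l + d)"
proof (cases "norm y \<le> exp (- (l + d))")
  case True
  then show ?thesis using log_bump_grad_eq_0[OF assms, of l y] assms by simp
next
  case False
  then have "y \<noteq> 0" by auto
  note norm_log_bump_grad_le[OF assms]
  also have "2 / d / norm y \<le> 2 / d / exp (- (l + d))"
    using assms False \<open>y \<noteq> 0\<close> by (intro divide_left_mono mult_pos_pos) auto
  finally show ?thesis by (simp only: exp_minus divide_inverse inverse_inverse_eq)
qed

lemma has_derivative_log_bump:
  fixes y :: "'a::real_inner"
  assumes d_pos: "d > 0"
  shows "(log_bump l d has_derivative (\<lambda>h. log_bump_grad l d y \<bullet> h)) (at y)"
proof (cases "y = 0")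
  case True
  have "(log_bump l d has_derivative (\<lambda>h. 0)) (at y)"
  proof (rule has_derivative_transform_within_open[OF has_derivative_const])
    show "1 = log_bump l d z" if "z \<in> ball 0 (exp (- (l + d)))" for z :: 'a
      using log_bump_eq_1[OF d_pos, of z l] that by simp
  qed (use True in simp_all)
  then show ?thesis using True by (simp add: log_bump_grad_def)
next
  case False
  have "((\<lambda>z. norm z) has_derivative (\<lambda>h. (y \<bullet> h) / norm y)) (at y)"
    using has_derivative_norm[OF False] by (simp add: sgn_div_norm inner_commute divide_inverse mult.commute)
  then have "(log_depth l d has_derivative (\<lambda>h. - ((y \<bullet> h) / norm y / norm y) / d)) (at y)"
    unfolding log_depth_def[abs_def] using False d_pos by (auto intro!: derivative_eq_intros simp: divide_inverse)
  from DERIV_compose_FDERIV[OF DERIV_smooth_step this]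
  have "((\<lambda>z. smooth_step (log_depth l d z)) has_derivative (\<lambda>h. log_bump_grad l d y \<bullet> h)) (at y)"
    by (simp add: log_bump_grad_def power2_eq_square divide_inverse mult_ac)
  then show ?thesis
  proof (rule has_derivative_transform_within_open)
    show "open (- {0::'a})" by (intro open_Compl closed_singleton)
  qed (use False in \<open>simp_all add: log_bump_def\<close>)
qed

lemma borel_measurable_log_bump_grad [measurable (raw)]:
  fixes f :: "'b \<Rightarrow> 'a::euclidean_space"
  assumes [measurable]: "f \<in> borel_measurable M"
  shows "(\<lambda>x. log_bump_grad l d (f x)) \<in> borel_measurable M"
proof -
  have [measurable]: "smooth_step' \<in> borel_measurable borel"
    unfolding smooth_step'_def[abs_def] by measurable
  show ?thesis unfolding log_bump_grad_def log_depth_def by measurable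
qed

section \<open>Series in Orlicz--Sobolev spaces\<close>

lemma young_function_ident: "young_function (\<lambda>t. t)"
  by (auto simp: young_function_def convex_on_ident intro: exI[of _ 1])

lemma young_function_nonneg: "young_function A \<Longrightarrow> 0 \<le> t \<Longrightarrow> 0 \<le> A t"
  by (simp add: young_function_def)

lemma young_function_scale:
  assumes "young_function A" "0 \<le> c" "c \<le> 1" "0 \<le> t"
  shows "A (c * t) \<le> c * A t"
  using assms convex_onD[of "{0..}" A c 0 t] by (simp add: young_function_def)

lemma young_function_mono:
  assumes young: "young_function A" and "0 \<le> s" "s \<le> t"
  shows "A s \<le> A t"
proof (cases "t = 0")
  case False
  then have "0 \<le> s / t" "s / t \<le> 1" "t > 0" using assms by auto
  then have "A s \<le> s / t * A t" using young_function_scale[OF young, of "s / t" t] by simp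
  also have "\<dots> \<le> A t"
    using \<open>s / t \<le> 1\<close> \<open>t > 0\<close> young_function_nonneg[OF young, of t] mult_right_mono[of "s / t" 1 "A t"] by simp
  finally show ?thesis .
qed (use assms in simp)

lemma young_function_sum_le:
  assumes young: "young_function A" and "finite I" and weights: "\<And>i. i \<in> I \<Longrightarrow> 0 \<le> a i" "sum a I \<le> 1"
    and t_nonneg: "\<And>i. i \<in> I \<Longrightarrow> 0 \<le> t i"
  shows "A (\<Sum>i\<in>I. a i * t i) \<le> (\<Sum>i\<in>I. a i * A (t i))"
proof (cases "sum a I = 0")
  case True
  then have "a i = 0" if "i \<in> I" for i using sum_nonneg_eq_0_iff[OF \<open>finite I\<close>] weights(1) that by blast
  then show ?thesis using young by (simp add: young_function_def)
next
  case False
  let ?s = "sum a I"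
  have s_pos: "?s > 0" using False sum_nonneg[of I a] weights(1) by simp
  have "A (\<Sum>i\<in>I. a i * t i) = A (?s * (\<Sum>i\<in>I. (a i / ?s) * t i))"
    using s_pos by (simp add: sum_distrib_left)
  also have "\<dots> \<le> ?s * A (\<Sum>i\<in>I. (a i / ?s) * t i)"
    using s_pos weights t_nonneg by (intro young_function_scale[OF young] sum_nonneg) auto
  also have "A (\<Sum>i\<in>I. (a i / ?s) * t i) \<le> (\<Sum>i\<in>I. (a i / ?s) * A (t i))"
  proof -
    have "convex_on {0..} A" using young by (simp add: young_function_def)
    moreover have "I \<noteq> {}" using False by auto
    ultimately show ?thesis
      using convex_on_sum[OF \<open>finite I\<close>, of "{0..}" A "\<lambda>i. a i / ?s" t] s_pos weights(1) t_nonneg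
      by (simp add: sum_divide_distrib[symmetric])
  qed
  also have "?s * (\<Sum>i\<in>I. (a i / ?s) * A (t i)) = (\<Sum>i\<in>I. a i * A (t i))"
    using s_pos by (simp add: sum_distrib_left)
  finally show ?thesis using s_pos by (simp add: mult_left_mono)
qed

lemma young_function_isCont:
  assumes "young_function A" "t > 0"
  shows "isCont A t"
proof -
  have "convex_on {0<..} A" using assms(1) by (auto simp: young_function_def intro: convex_on_subset)
  then have "continuous_on {0<..} A" by (rule convex_on_continuous[OF open_greaterThan])
  then show ?thesis using assms(2) by (simp add: continuous_on_eq_continuous_at)
qed

lemma borel_measurable_young_function_norm:
  fixes f :: "'a \<Rightarrow> 'b::{real_normed_vector, second_countable_topology}"
  assumes young: "young_function A" and [measurable]: "f \<in> borel_measurable M"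
  shows "(\<lambda>x. A (norm (f x))) \<in> borel_measurable M"
proof -
  have "mono (\<lambda>t. A (max 0 t))" by (auto intro!: monoI young_function_mono[OF young])
  then have "(\<lambda>t. A (max 0 t)) \<in> borel_measurable borel" by (rule borel_measurable_mono)
  then have "(\<lambda>x. A (max 0 (norm (f x)))) \<in> borel_measurable M"
    by (rule measurable_compose[rotated]) measurable
  then show ?thesis by simp
qed

lemma young_function_norm_suminf_le:
  fixes v :: "nat \<Rightarrow> 'b::real_normed_vector"
  assumes young: "young_function A" and weights: "\<And>k. 0 \<le> a k" "summable a" "suminf a \<le> 1"
    and summable_v: "summable (\<lambda>k. a k *\<^sub>R v k)"
  shows "ennreal (A (norm (\<Sum>k. a k *\<^sub>R v k))) \<le> (\<Sum>k. ennreal (a k * A (norm (v k))))"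
proof (cases "(\<Sum>k. a k *\<^sub>R v k) = 0")
  case True
  then show ?thesis using young by (simp add: young_function_def)
next
  case False
  let ?v = "\<lambda>N. \<Sum>k<N. a k *\<^sub>R v k"
  have "(\<lambda>N. norm (?v N)) \<longlonglongrightarrow> norm (\<Sum>k. a k *\<^sub>R v k)"
    by (intro tendsto_norm summable_LIMSEQ summable_v)
  then have "(\<lambda>N. ennreal (A (norm (?v N)))) \<longlonglongrightarrow> ennreal (A (norm (\<Sum>k. a k *\<^sub>R v k)))"
    using False by (intro tendsto_ennrealI isCont_tendsto_compose[OF young_function_isCont[OF young]]) auto
  moreover have "ennreal (A (norm (?v N))) \<le> (\<Sum>k. ennreal (a k * A (norm (v k))))" for N
  proof -
    have "norm (?v N) \<le> (\<Sum>k<N. a k * norm (v k))"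
      using norm_sum[of "\<lambda>k. a k *\<^sub>R v k" "{..<N}"] weights(1) by simp
    then have "A (norm (?v N)) \<le> A (\<Sum>k<N. a k * norm (v k))" by (intro young_function_mono[OF young]) auto
    also have "\<dots> \<le> (\<Sum>k<N. a k * A (norm (v k)))"
      using sum_le_suminf[OF weights(2), of "{..<N}"] weights(1,3) by (intro young_function_sum_le[OF young]) auto
    finally have "ennreal (A (norm (?v N))) \<le> ennreal (\<Sum>k<N. a k * A (norm (v k)))" by (rule ennreal_leI)
    also have "\<dots> = (\<Sum>k<N. ennreal (a k * A (norm (v k))))"
      using weights(1) young_function_nonneg[OF young] by (intro sum_ennreal[symmetric]) simp
    also have "\<dots> \<le> (\<Sum>k. ennreal (a k * A (norm (v k))))" by (rule sum_le_suminf) auto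
    finally show ?thesis .
  qed
  ultimately show ?thesis by (intro LIMSEQ_le_const2) auto
qed

lemma in_orlicz_if_nn_integral_finite:
  assumes young: "young_function A" and f_measurable: "f \<in> borel_measurable lebesgue"
    and "(\<integral>\<^sup>+x. ennreal (A \<bar>f x\<bar>) \<partial>lebesgue) \<le> ennreal C"
  shows "in_orlicz A f"
  unfolding in_orlicz_def
proof (intro conjI f_measurable exI[of _ "max 1 C"])
  let ?l = "max 1 C"
  have [measurable]: "(\<lambda>x. A \<bar>f x\<bar>) \<in> borel_measurable lebesgue"
    using borel_measurable_young_function_norm[OF young f_measurable] by simp
  have "A (\<bar>f x\<bar> / ?l) \<le> 1 / ?l * A \<bar>f x\<bar>" for x
    using young_function_scale[OF young, of "1 / ?l" "\<bar>f x\<bar>"] by simp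
  then have "(\<integral>\<^sup>+x. ennreal (A (\<bar>f x\<bar> / ?l)) \<partial>lebesgue) \<le> (\<integral>\<^sup>+x. ennreal (1 / ?l) * ennreal (A \<bar>f x\<bar>) \<partial>lebesgue)"
    by (intro nn_integral_mono) (simp add: ennreal_mult'[symmetric] ennreal_leI)
  also have "\<dots> = ennreal (1 / ?l) * (\<integral>\<^sup>+x. ennreal (A \<bar>f x\<bar>) \<partial>lebesgue)" by (rule nn_integral_cmult) simp
  also have "\<dots> \<le> ennreal (1 / ?l) * ennreal ?l"
    using assms(3) by (intro mult_left_mono) (auto intro: order_trans ennreal_leI)
  also have "\<dots> = 1" by (simp add: ennreal_mult'[symmetric])
  finally show "(\<integral>\<^sup>+x. ennreal (A (\<bar>f x\<bar> / ?l)) \<partial>lebesgue) \<le> 1" .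
qed simp

lemma continuous_on_imp_lebesgue_measurable:
  fixes f :: "'a::euclidean_space \<Rightarrow> 'b::euclidean_space"
  assumes "continuous_on UNIV f"
  shows "f \<in> borel_measurable lebesgue"
  using borel_measurable_continuous_onI[OF assms] by (intro measurable_completion) simp

lemma continuous_on_imp_locally_integrable:
  fixes u :: "real^'n::finite \<Rightarrow> real^'m::finite"
  assumes "continuous_on UNIV u"
  shows "locally_integrable u"
  unfolding locally_integrable_def set_integrable_def
proof (intro allI impI)
  fix K :: "(real^'n) set" assume "compact K"
  then have "integrable lborel (\<lambda>x. indicator K x *\<^sub>R u x)"
    using assms by (intro borel_integrable_compact) (auto intro: continuous_on_subset)
  then show "integrable lebesgue (\<lambda>x. indicator K x *\<^sub>R u x)"
    by (simp add: integrable_completion borel_measurable_integrable)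
qed

lemma integrable_imp_locally_integrable:
  "integrable lebesgue f \<Longrightarrow> locally_integrable f"
  unfolding locally_integrable_def set_integrable_def
  by (intro allI impI integrable_mult_indicator) (simp_all add: compact_imp_closed)

lemma abs_matrix_nth_le_norm: "\<bar>(G :: real^'n^'m) $ i $ j\<bar> \<le> norm G"
  using component_le_norm_cart[of "G $ i" j] Finite_Cartesian_Product.norm_nth_le[of G i] by linarith

lemma borel_measurable_vec_nth [measurable (raw)]:
  fixes f :: "'a \<Rightarrow> ('b::real_normed_vector)^'n::finite"
  assumes "f \<in> borel_measurable M"
  shows "(\<lambda>x. f x $ i) \<in> borel_measurable M"
  by (rule measurable_compose[OF assms borel_measurable_continuous_onI]) (intro continuous_intros)

lemma weak_gradient_has_derivative:
  fixes u :: "real^'n::finite \<Rightarrow> real^'n" and G :: "real^'n \<Rightarrow> real^'n^'n"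
  assumes deriv: "\<And>x. (u has_derivative (*v) (G x)) (at x)"
    and G_bounds: "integrable lebesgue G" "G \<in> borel_measurable borel" "\<And>x. norm (G x) \<le> B"
  shows "weak_gradient u G"
proof -
  have continuous_u: "continuous_on UNIV u"
    using deriv by (meson continuous_at_imp_continuous_on has_derivative_continuous)
  have [measurable]: "G \<in> borel_measurable borel" "u \<in> borel_measurable borel"
    using G_bounds(2) continuous_u by (auto intro: borel_measurable_continuous_onI)
  show ?thesis
    unfolding weak_gradient_def
  proof (intro conjI allI impI)
    show "locally_integrable u" by (rule continuous_on_imp_locally_integrable[OF continuous_u])
    show "locally_integrable G" by (rule integrable_imp_locally_integrable[OF G_bounds(1)])
    fix \<psi> :: "real^'n \<Rightarrow> real" and i j assume test: "test_function \<psi>"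
    note support = test_function_continuous_compact_support[OF test]
    have [measurable]: "\<psi> \<in> borel_measurable borel" "partial_deriv j \<psi> \<in> borel_measurable borel"
      using support by (auto simp: continuous_compact_support_def intro: borel_measurable_continuous_onI)
    have "((\<lambda>x. u x $ i) has_derivative (\<lambda>h. (G x *v h) $ i)) (at x)" for x
      by (rule bounded_linear.has_derivative[OF bounded_linear_vec_nth deriv])
    from has_derivative_imp_directional[OF this, of _ "axis j 1"]
    have "((\<lambda>t. u (x + t *\<^sub>R axis j 1) $ i) has_real_derivative G x $ i $ j) (at 0)" for x
      by (simp add: matrix_vector_mul_component inner_axis)
    then have "(\<integral>x. u x $ i * partial_deriv j \<psi> x \<partial>lborel) = - (\<integral>x. G x $ i $ j * \<psi> x \<partial>lborel)"
      using continuous_u order_trans[OF abs_matrix_nth_le_norm G_bounds(3)]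
      by (intro integral_by_parts_directional[OF _ _ support _ test_function_directional_derivative[OF test]])
        (auto intro: continuous_intros)
    then show "(\<integral>x. u x $ i * partial_deriv j \<psi> x \<partial>lebesgue) = - (\<integral>x. G x $ i $ j * \<psi> x \<partial>lebesgue)"
      by (subst (1 2) integral_completion) measurable
  qed
qed

lemma locally_integrable_scaleR:
  "locally_integrable f \<Longrightarrow> locally_integrable (\<lambda>x. c *\<^sub>R f x)"
  unfolding locally_integrable_def by (simp add: set_integrable_scaleR_right)

lemma weak_gradient_scaleR:
  assumes "weak_gradient u G"
  shows "weak_gradient (\<lambda>x. c *\<^sub>R u x) (\<lambda>x. c *\<^sub>R G x)"
  using assms by (simp add: weak_gradient_def locally_integrable_scaleR mult.assoc)

lemma AE_summable_norm_if_summable_integral_norm: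
  fixes f :: "nat \<Rightarrow> 'a \<Rightarrow> 'b::{banach, second_countable_topology}"
  assumes int_f: "\<And>k. integrable M (f k)" and "summable (\<lambda>k. \<integral>x. norm (f k x) \<partial>M)"
  shows "AE x in M. summable (\<lambda>k. norm (f k x))"
proof -
  have [measurable]: "f k \<in> borel_measurable M" for k using int_f by auto
  have "(\<integral>\<^sup>+x. (\<Sum>k. ennreal (norm (f k x))) \<partial>M) = (\<Sum>k. \<integral>\<^sup>+x. ennreal (norm (f k x)) \<partial>M)"
    by (rule nn_integral_suminf) simp
  also have "\<dots> = (\<Sum>k. ennreal (\<integral>x. norm (f k x) \<partial>M))"
    using int_f by (simp add: nn_integral_eq_integral)
  also have "\<dots> < \<infinity>" using assms(2) by (simp add: ennreal_suminf_neq_top less_top[symmetric])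
  finally have "AE x in M. (\<Sum>k. ennreal (norm (f k x))) \<noteq> \<infinity>"
    by (intro nn_integral_PInf_AE) auto
  then show ?thesis by eventually_elim (rule summable_suminf_not_top, simp_all)
qed

lemma sums_integral_if_norm_bounded:
  fixes f :: "nat \<Rightarrow> 'a \<Rightarrow> 'b::{banach, second_countable_topology}" and g :: "nat \<Rightarrow> 'a \<Rightarrow> real"
  assumes f_bound: "\<And>k. f k \<in> borel_measurable M" "\<And>k x. norm (f k x) \<le> g k x"
    and int_g: "\<And>k. integrable M (g k)" "summable (\<lambda>k. \<integral>x. g k x \<partial>M)"
  shows "(\<lambda>k. \<integral>x. f k x \<partial>M) sums (\<integral>x. (\<Sum>k. f k x) \<partial>M)"
proof -
  have int_f: "integrable M (f k)" for k
    by (rule Bochner_Integration.integrable_bound[OF int_g(1) f_bound(1)])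
      (use f_bound(2)[of k] order_trans[OF _ abs_ge_self] in auto)
  have summable_int_f: "summable (\<lambda>k. \<integral>x. norm (f k x) \<partial>M)"
  proof (rule summable_comparison_test'[OF int_g(2)])
    show "norm (\<integral>x. norm (f k x) \<partial>M) \<le> (\<integral>x. g k x \<partial>M)" for k
      using integral_mono[OF integrable_norm[OF int_f] int_g(1) f_bound(2)] by simp
  qed
  show ?thesis
    by (rule sums_integral[OF int_f AE_summable_norm_if_summable_integral_norm[OF int_f] summable_int_f])
      (rule summable_int_f)
qed

lemma sums_integral_uniform_series:
  fixes f :: "nat \<Rightarrow> real^'n::finite \<Rightarrow> real^'m::finite"
  assumes f_series: "\<And>k. continuous_on UNIV (f k)" "\<And>k x. norm (f k x) \<le> b k" "summable b"
    and compact_support: "continuous_compact_support p"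
  shows "(\<lambda>k. \<integral>x. f k x $ i * p x \<partial>lebesgue) sums (\<integral>x. (\<Sum>k. f k x) $ i * p x \<partial>lebesgue)"
proof -
  have [measurable]: "p \<in> borel_measurable lebesgue" "f k \<in> borel_measurable lebesgue" for k
    using compact_support f_series(1)
    by (auto simp: continuous_compact_support_def intro: continuous_on_imp_lebesgue_measurable)
  have int_p: "integrable lebesgue (\<lambda>x. \<bar>p x\<bar>)"
    using integrable_continuous_compact_support[OF compact_support] by (simp add: integrable_completion)
  have "(\<lambda>k. \<integral>x. f k x $ i * p x \<partial>lebesgue) sums (\<integral>x. (\<Sum>k. f k x $ i * p x) \<partial>lebesgue)"
  proof (rule sums_integral_if_norm_bounded)
    show "norm (f k x $ i * p x) \<le> b k * \<bar>p x\<bar>" for k x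
      using order_trans[OF component_le_norm_cart f_series(2)] by (simp add: abs_mult mult_right_mono)
    show "summable (\<lambda>k. \<integral>x. b k * \<bar>p x\<bar> \<partial>lebesgue)"
      using summable_mult2[OF f_series(3)] by simp
  qed (use int_p in auto)
  moreover have "(\<Sum>k. f k x $ i * p x) = (\<Sum>k. f k x) $ i * p x" for x
  proof -
    have "summable (\<lambda>k. f k x)" by (rule summable_comparison_test'[OF f_series(3) f_series(2)])
    from bounded_linear.sums[OF bounded_linear_vec_nth summable_sums[OF this]]
    show ?thesis by (intro sums_unique[symmetric] sums_mult2)
  qed
  ultimately show ?thesis by simp
qed

lemma sums_integral_L1_series:
  fixes F :: "nat \<Rightarrow> real^'n::finite \<Rightarrow> real^'l::finite^'m::finite"
  assumes F_series: "\<And>k. integrable lebesgue (F k)" "summable (\<lambda>k. \<integral>x. norm (F k x) \<partial>lebesgue)"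
    and compact_support: "continuous_compact_support \<psi>"
  shows "(\<lambda>k. \<integral>x. F k x $ i $ j * \<psi> x \<partial>lebesgue) sums (\<integral>x. (\<Sum>k. F k x) $ i $ j * \<psi> x \<partial>lebesgue)"
proof -
  have [measurable]: "\<psi> \<in> borel_measurable lebesgue" "F k \<in> borel_measurable lebesgue" for k
    using compact_support F_series(1)
    by (auto simp: continuous_compact_support_def intro: continuous_on_imp_lebesgue_measurable)
  obtain B where \<psi>_bound: "\<And>x. \<bar>\<psi> x\<bar> \<le> B"
    using continuous_compact_support_bounded[OF compact_support] by blast
  have "(\<lambda>k. \<integral>x. F k x $ i $ j * \<psi> x \<partial>lebesgue) sums (\<integral>x. (\<Sum>k. F k x $ i $ j * \<psi> x) \<partial>lebesgue)"
  proof (rule sums_integral_if_norm_bounded)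
    show "norm (F k x $ i $ j * \<psi> x) \<le> norm (F k x) * B" for k x
      using abs_matrix_nth_le_norm[of "F k x" i j] \<psi>_bound[of x] by (simp add: abs_mult mult_mono)
    show "summable (\<lambda>k. \<integral>x. norm (F k x) * B \<partial>lebesgue)"
      using summable_mult2[OF F_series(2)] F_series(1) by simp
  qed (use F_series(1) in auto)
  moreover have "(\<integral>x. (\<Sum>k. F k x $ i $ j * \<psi> x) \<partial>lebesgue) = (\<integral>x. (\<Sum>k. F k x) $ i $ j * \<psi> x \<partial>lebesgue)"
  proof (rule integral_cong_AE)
    show "AE x in lebesgue. (\<Sum>k. F k x $ i $ j * \<psi> x) = (\<Sum>k. F k x) $ i $ j * \<psi> x"
      using AE_summable_norm_if_summable_integral_norm[OF F_series]
    proof eventually_elim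
      case (elim x)
      have "bounded_linear (\<lambda>G :: real^'l^'m. G $ i $ j * \<psi> x)"
        by (intro bounded_linear_intros bounded_linear_compose[OF bounded_linear_vec_nth bounded_linear_vec_nth])
      then show ?case by (rule bounded_linear.suminf[symmetric, OF _ summable_norm_cancel[OF elim]])
    qed
  qed measurable
  ultimately show ?thesis by simp
qed

lemma weak_gradient_suminf:
  fixes f :: "nat \<Rightarrow> real^'n::finite \<Rightarrow> real^'n" and F :: "nat \<Rightarrow> real^'n \<Rightarrow> real^'n^'n"
  assumes f_series: "\<And>k. continuous_on UNIV (f k)" "\<And>k x. norm (f k x) \<le> b k" "summable b"
    and F_series: "\<And>k. integrable lebesgue (F k)" "summable (\<lambda>k. \<integral>x. norm (F k x) \<partial>lebesgue)"
    and weak: "\<And>k. weak_gradient (f k) (F k)"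
  shows "weak_gradient (\<lambda>x. \<Sum>k. f k x) (\<lambda>x. \<Sum>k. F k x)"
  unfolding weak_gradient_def
proof (intro conjI allI impI)
  have "continuous_on UNIV (\<lambda>x. \<Sum>k. f k x)" by (rule continuous_on_suminf[OF f_series])
  then show "locally_integrable (\<lambda>x. \<Sum>k. f k x)" by (rule continuous_on_imp_locally_integrable)
  have "integrable lebesgue (\<lambda>x. \<Sum>k. F k x)"
    by (rule integrable_suminf[OF F_series(1) AE_summable_norm_if_summable_integral_norm[OF F_series] F_series(2)])
  then show "locally_integrable (\<lambda>x. \<Sum>k. F k x)" by (rule integrable_imp_locally_integrable)
  fix \<psi> :: "real^'n \<Rightarrow> real" and i j assume test: "test_function \<psi>"
  note support = test_function_continuous_compact_support[OF test]
  have "(\<integral>x. f k x $ i * partial_deriv j \<psi> x \<partial>lebesgue) = - (\<integral>x. F k x $ i $ j * \<psi> x \<partial>lebesgue)" for k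
    using weak[of k] test by (simp add: weak_gradient_def)
  then show "(\<integral>x. (\<Sum>k. f k x) $ i * partial_deriv j \<psi> x \<partial>lebesgue) = - (\<integral>x. (\<Sum>k. F k x) $ i $ j * \<psi> x \<partial>lebesgue)"
    using sums_unique2[OF sums_integral_uniform_series[OF f_series support(2)]]
      sums_minus[OF sums_integral_L1_series[OF F_series support(1)]] by simp
qed

lemma nn_integral_young_function_suminf_le:
  fixes F :: "nat \<Rightarrow> 'a \<Rightarrow> 'b::{banach, second_countable_topology}"
  assumes young: "young_function A" and weights: "\<And>k. 0 \<le> a k" "summable a" "suminf a \<le> 1"
    and [measurable]: "\<And>k. F k \<in> borel_measurable M"
    and summable: "AE x in M. summable (\<lambda>k. norm (a k *\<^sub>R F k x))"
    and energy: "\<And>k. (\<integral>\<^sup>+x. ennreal (A (norm (F k x))) \<partial>M) \<le> ennreal C"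
  shows "(\<integral>\<^sup>+x. ennreal (A (norm (\<Sum>k. a k *\<^sub>R F k x))) \<partial>M) \<le> ennreal C"
proof -
  have [measurable]: "(\<lambda>x. A (norm (F k x))) \<in> borel_measurable M" for k
    by (rule borel_measurable_young_function_norm[OF young]) measurable
  have "AE x in M. ennreal (A (norm (\<Sum>k. a k *\<^sub>R F k x))) \<le> (\<Sum>k. ennreal (a k * A (norm (F k x))))"
    using summable
    by eventually_elim (simp add: young_function_norm_suminf_le[OF young weights] summable_norm_cancel)
  then have "(\<integral>\<^sup>+x. ennreal (A (norm (\<Sum>k. a k *\<^sub>R F k x))) \<partial>M)
      \<le> (\<integral>\<^sup>+x. (\<Sum>k. ennreal (a k * A (norm (F k x)))) \<partial>M)"
    by (rule nn_integral_mono_AE)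
  also have "\<dots> = (\<Sum>k. \<integral>\<^sup>+x. ennreal (a k * A (norm (F k x))) \<partial>M)"
    by (rule nn_integral_suminf) simp
  also have "\<dots> = (\<Sum>k. ennreal (a k) * (\<integral>\<^sup>+x. ennreal (A (norm (F k x))) \<partial>M))"
    using weights(1) by (simp add: ennreal_mult' nn_integral_cmult)
  also have "\<dots> \<le> (\<Sum>k. ennreal (a k) * ennreal C)"
    using energy by (intro suminf_le mult_left_mono) auto
  also have "\<dots> = ennreal (suminf a) * ennreal C" using weights by (simp add: suminf_ennreal2)
  also have "\<dots> \<le> ennreal 1 * ennreal C" using weights(3) by (intro mult_right_mono ennreal_leI) auto
  finally show ?thesis by simp
qed

lemma integrable_if_nn_integral_norm_le:
  fixes f :: "'a \<Rightarrow> 'b::{banach, second_countable_topology}"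
  assumes "f \<in> borel_measurable M" and norm_le: "(\<integral>\<^sup>+x. ennreal (norm (f x)) \<partial>M) \<le> ennreal C" "C \<ge> 0"
  shows "integrable M f" "(\<integral>x. norm (f x) \<partial>M) \<le> C"
proof -
  show int_f: "integrable M f"
    using assms(1) le_less_trans[OF norm_le(1)] by (intro integrableI_bounded) auto
  have "ennreal (\<integral>x. norm (f x) \<partial>M) = (\<integral>\<^sup>+x. ennreal (norm (f x)) \<partial>M)"
    by (rule nn_integral_eq_integral[symmetric, OF integrable_norm[OF int_f]]) simp
  also have "\<dots> \<le> ennreal C" by (rule norm_le(1))
  finally show "(\<integral>x. norm (f x) \<partial>M) \<le> C" using norm_le(2) by simp
qed

theorem V1A_suminf:
  fixes f :: "nat \<Rightarrow> real^'n::finite \<Rightarrow> real^'n" and F :: "nat \<Rightarrow> real^'n \<Rightarrow> real^'n^'n"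
  assumes young: "young_function A" and weights: "\<And>k. 0 \<le> a k" "summable a" "suminf a \<le> 1"
    and f_bounded: "\<And>k. continuous_on UNIV (f k)" "\<And>k x. norm (f k x) \<le> B"
    and weak: "\<And>k. weak_gradient (f k) (F k)"
    and F_measurable: "\<And>k. F k \<in> borel_measurable lebesgue"
    and F_L1_bound: "\<And>k. (\<integral>\<^sup>+x. ennreal (norm (F k x)) \<partial>lebesgue) \<le> ennreal C" "C \<ge> 0"
    and energy: "\<And>k. (\<integral>\<^sup>+x. ennreal (A (norm (F k x))) \<partial>lebesgue) \<le> ennreal D"
  shows "(\<lambda>x. \<Sum>k. a k *\<^sub>R f k x) \<in> V1A A" "continuous_on UNIV (\<lambda>x. \<Sum>k. a k *\<^sub>R f k x)"
proof -
  let ?G = "\<lambda>x. \<Sum>k. a k *\<^sub>R F k x"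
  note int_F = integrable_if_nn_integral_norm_le[OF F_measurable F_L1_bound]
  have continuous_f: "continuous_on UNIV (\<lambda>x. a k *\<^sub>R f k x)" for k by (intro continuous_intros f_bounded)
  have norm_f: "norm (a k *\<^sub>R f k x) \<le> a k * B" for k x using weights(1) f_bounded(2) by (simp add: mult_left_mono)
  have int_aF: "integrable lebesgue (\<lambda>x. a k *\<^sub>R F k x)" for k using int_F(1) by simp
  have summable_int_aF: "summable (\<lambda>k. \<integral>x. norm (a k *\<^sub>R F k x) \<partial>lebesgue)"
  proof (rule summable_comparison_test'[OF summable_mult2[OF weights(2)]])
    show "norm (\<integral>x. norm (a k *\<^sub>R F k x) \<partial>lebesgue) \<le> a k * C" for k
      using weights(1)[of k] int_F(2)[of k] by (simp add: abs_mult mult_left_mono)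
  qed
  note summable_aF = AE_summable_norm_if_summable_integral_norm[OF int_aF summable_int_aF]
  show "continuous_on UNIV (\<lambda>x. \<Sum>k. a k *\<^sub>R f k x)"
    by (rule continuous_on_suminf[OF continuous_f norm_f summable_mult2[OF weights(2)]])
  have "weak_gradient (\<lambda>x. \<Sum>k. a k *\<^sub>R f k x) ?G"
    by (rule weak_gradient_suminf[OF continuous_f norm_f summable_mult2[OF weights(2)] int_aF summable_int_aF
          weak_gradient_scaleR[OF weak]])
  moreover have "in_orlicz A (\<lambda>x. norm (?G x))"
    using F_measurable nn_integral_young_function_suminf_le[OF young weights F_measurable summable_aF energy]
    by (intro in_orlicz_if_nn_integral_finite[OF young]) auto
  ultimately show "(\<lambda>x. \<Sum>k. a k *\<^sub>R f k x) \<in> V1A A" unfolding V1A_def by blast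
qed

section \<open>Energy of separated cutoffs\<close>

lemma inverse_power_le_dyadic_sum:
  fixes y :: "'a::euclidean_space"
  assumes y_range: "exp (- T) < norm y" "norm y < 1" and N_ge: "T / ln 2 \<le> real N"
  shows "(1 / norm y) ^ n \<le> (\<Sum>i\<le>N. 2 ^ (Suc i * n) * indicator (cball 0 ((1/2) ^ i)) y)"
proof -
  have "norm y > 0" using y_range(1) exp_gt_zero[of "- T"] by linarith
  then obtain i where i_bracket: "(1/2) ^ Suc i \<le> norm y" "norm y < (1/2) ^ i"
    using tendsto_0_bracket[of "\<lambda>i. (1/2) ^ i" "norm y" 0] y_range(2) LIMSEQ_realpow_zero[of "1/2"] by auto
  have "ln (exp (- T)) \<le> ln ((1/2) ^ i)" using i_bracket(2) y_range(1) by (intro ln_mono) auto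
  then have "real i * ln 2 \<le> T" by (simp add: ln_realpow ln_div)
  then have "real i \<le> T / ln 2" by (simp add: pos_le_divide_eq)
  then have "i \<le> N" using N_ge by linarith
  have "1 / norm y \<le> 2 ^ Suc i"
    using frac_le[of 1 1 "(1/2) ^ Suc i" "norm y"] i_bracket(1) by (simp add: power_one_over)
  then have "(1 / norm y) ^ n \<le> (2 ^ Suc i) ^ n" by (intro power_mono) auto
  also have "\<dots> = 2 ^ (Suc i * n) * indicator (cball 0 ((1/2) ^ i)) y"
    using i_bracket(2) by (simp only: power_mult[symmetric]) (simp add: indicator_def)
  also have "\<dots> \<le> (\<Sum>i\<le>N. 2 ^ (Suc i * n) * indicator (cball 0 ((1/2) ^ i)) y)"
    using \<open>i \<le> N\<close>
    by (intro member_le_sum[of i "{..N}" "\<lambda>i. 2 ^ (Suc i * n) * indicator (cball 0 ((1/2) ^ i)) y"]) auto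
  finally show ?thesis .
qed

definition annulus :: "'a::real_normed_vector \<Rightarrow> real \<Rightarrow> real \<Rightarrow> 'a set" where
  "annulus c r R = {x. r < norm (x - c) \<and> norm (x - c) < R}"

lemma annulus_borel [measurable]: "annulus c r R \<in> sets (borel :: 'a::euclidean_space measure)"
  unfolding annulus_def by measurable

lemma nn_integral_dyadic_sum:
  fixes c :: "'a::euclidean_space"
  shows "(\<integral>\<^sup>+x. (\<Sum>i\<le>N. ennreal (2 ^ (Suc i * DIM('a))) * indicator (cball c ((1/2) ^ i)) x) \<partial>lborel)
    = ennreal ((real N + 1) * 2 ^ DIM('a) * unit_ball_vol DIM('a))"
proof -
  let ?n = "DIM('a)"
  have volume: "ennreal (2 ^ (Suc i * ?n)) * emeasure lborel (cball c ((1/2) ^ i))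
      = ennreal (2 ^ ?n * unit_ball_vol ?n)" for i
  proof -
    have "(2::real) ^ (Suc i * ?n) * ((1/2) ^ i) ^ ?n = 2 ^ ?n"
      by (simp add: power_add power_mult[symmetric] power_one_over)
    then have "2 ^ (Suc i * ?n) * (unit_ball_vol ?n * ((1/2) ^ i) ^ ?n) = 2 ^ ?n * unit_ball_vol ?n"
      by (metis mult.assoc mult.commute)
    then show ?thesis
      by (simp only: emeasure_cball zero_le_power zero_le_divide_1_iff zero_le_numeral ennreal_mult'[symmetric])
  qed
  have "(\<integral>\<^sup>+x. (\<Sum>i\<le>N. ennreal (2 ^ (Suc i * ?n)) * indicator (cball c ((1/2) ^ i)) x) \<partial>lborel)
      = (\<Sum>i\<le>N. ennreal (2 ^ (Suc i * ?n)) * emeasure lborel (cball c ((1/2) ^ i)))"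
    by (subst nn_integral_sum)
      (simp_all add: nn_integral_cmult_indicator borel_measurable_times_ennreal borel_measurable_indicator)
  then show ?thesis
    unfolding volume by (simp add: ennreal_mult' ennreal_of_nat_eq_real_of_nat[symmetric] mult.assoc add.commute)
qed

lemma nn_integral_inverse_power_annulus_le:
  fixes c :: "'a::euclidean_space"
  assumes "T \<ge> 1"
  shows "(\<integral>\<^sup>+x. ennreal ((1 / norm (x - c)) ^ DIM('a)) * indicator (annulus c (exp (- T)) 1) x \<partial>lborel)
    \<le> ennreal (4 * T * 2 ^ DIM('a) * unit_ball_vol DIM('a))"
proof -
  let ?n = "DIM('a)" and ?N = "nat \<lceil>T / ln 2\<rceil>"
  have "ennreal ((1 / norm (x - c)) ^ ?n) * indicator (annulus c (exp (- T)) 1) x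
      \<le> (\<Sum>i\<le>?N. ennreal (2 ^ (Suc i * ?n)) * indicator (cball c ((1/2) ^ i)) x)" for x
  proof (cases "x \<in> annulus c (exp (- T)) 1")
    case True
    then have "ennreal ((1 / norm (x - c)) ^ ?n)
        \<le> ennreal (\<Sum>i\<le>?N. 2 ^ (Suc i * ?n) * indicator (cball 0 ((1/2) ^ i)) (x - c))"
      using real_nat_ceiling_ge by (intro ennreal_leI inverse_power_le_dyadic_sum) (auto simp: annulus_def)
    also have "\<dots> = (\<Sum>i\<le>?N. ennreal (2 ^ (Suc i * ?n)) * indicator (cball c ((1/2) ^ i)) x)"
      by (subst sum_ennreal[symmetric]) (auto simp: indicator_def dist_norm norm_minus_commute intro!: sum.cong)
    finally show ?thesis using True by simp
  qed simp
  then have "(\<integral>\<^sup>+x. ennreal ((1 / norm (x - c)) ^ ?n) * indicator (annulus c (exp (- T)) 1) x \<partial>lborel)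
      \<le> ennreal ((real ?N + 1) * 2 ^ ?n * unit_ball_vol ?n)"
    unfolding nn_integral_dyadic_sum[symmetric, of _ c] by (intro nn_integral_mono)
  also have "\<dots> \<le> ennreal (4 * T * 2 ^ ?n * unit_ball_vol ?n)"
  proof (intro ennreal_leI mult_right_mono)
    have "ln 2 \<ge> (1/2::real)" using ln_le_minus_one[of "1/2::real"] by (simp add: ln_div)
    then have "T / ln 2 \<le> T / (1/2)" using assms by (intro divide_left_mono) auto
    then have "T / ln 2 \<le> 2 * T" by simp
    moreover have "T / ln 2 \<ge> 0" using assms by simp
    then have "real ?N \<le> T / ln 2 + 1" by linarith
    ultimately show "real ?N + 1 \<le> 4 * T" using assms by linarith
  qed auto
  finally show ?thesis .
qed

lemma young_function_inverse_le:
  fixes A :: "real \<Rightarrow> real" and q T \<rho> \<theta> t0 K :: real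
  assumes young: "young_function A" and growth: "\<And>t. t > t0 \<Longrightarrow> A t \<le> K * (t ^ n * ln t powr q)"
    and nonneg: "t0 \<ge> 1" "K \<ge> 0" "q \<ge> 0" and \<theta>_range: "0 \<le> \<theta>" "\<theta> \<le> 1"
    and \<rho>_ge: "exp (- T) \<le> \<rho>" and t_range: "0 \<le> t" "t \<le> \<theta> / \<rho>"
  shows "A t \<le> A t0 + K * \<theta> ^ n * T powr q * (1 / \<rho>) ^ n"
proof -
  have "\<rho> > 0" using \<rho>_ge exp_gt_zero[of "- T"] by linarith
  then have last_nonneg: "0 \<le> K * \<theta> ^ n * T powr q * (1 / \<rho>) ^ n" using \<theta>_range nonneg by simp
  have "A t0 \<ge> 0" using nonneg by (intro young_function_nonneg[OF young]) simp
  show ?thesis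
  proof (cases "t \<le> t0")
    case True
    then have "A t \<le> A t0" using t_range(1) by (intro young_function_mono[OF young])
    then show ?thesis using last_nonneg by linarith
  next
    case False
    then have "\<theta> / \<rho> > t0" using t_range(2) by linarith
    have "\<theta> / \<rho> \<le> 1 / exp (- T)" using \<theta>_range \<rho>_ge by (intro frac_le) auto
    also have "\<dots> = exp T" by (simp only: exp_minus inverse_eq_divide[symmetric] inverse_inverse_eq)
    finally have "ln (\<theta> / \<rho>) \<le> ln (exp T)"
      using \<open>\<theta> / \<rho> > t0\<close> nonneg by (intro ln_mono) auto
    then have "ln (\<theta> / \<rho>) \<le> T" by (simp only: ln_exp)
    moreover have "0 \<le> ln (\<theta> / \<rho>)" using \<open>\<theta> / \<rho> > t0\<close> nonneg by (intro ln_ge_zero) linarith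
    ultimately have "ln (\<theta> / \<rho>) powr q \<le> T powr q" using nonneg by (intro powr_mono2) auto
    then have "K * ((\<theta> / \<rho>) ^ n * ln (\<theta> / \<rho>) powr q) \<le> K * ((\<theta> / \<rho>) ^ n * T powr q)"
      using \<theta>_range \<open>\<rho> > 0\<close> nonneg by (intro mult_left_mono) auto
    also have "\<dots> = K * \<theta> ^ n * T powr q * (1 / \<rho>) ^ n" by (simp add: power_divide)
    finally have "A (\<theta> / \<rho>) \<le> K * \<theta> ^ n * T powr q * (1 / \<rho>) ^ n"
      using growth[OF \<open>\<theta> / \<rho> > t0\<close>] by linarith
    moreover have "A t \<le> A (\<theta> / \<rho>)" using t_range by (rule young_function_mono[OF young])
    ultimately show ?thesis using \<open>A t0 \<ge> 0\<close> by linarith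
  qed
qed

lemma young_log_bump_grad_le:
  fixes x c :: "'a::euclidean_space"
  assumes young: "young_function A" and growth: "\<And>t. t > t0 \<Longrightarrow> A t \<le> K * (t ^ n * ln t powr q)"
    and nonneg: "t0 \<ge> 1" "K \<ge> 0" "q \<ge> 0" and l_pos: "l > 0" and d_pos: "d > 0" and h_range: "0 \<le> h" "2 * h \<le> d"
  shows "ennreal (A (h * norm (log_bump_grad l d (x - c)))) \<le> ennreal (A t0) * indicator (cball c (exp (- l))) x
    + ennreal (K * (2 * h / d) ^ n * (l + d) powr q)
      * (ennreal ((1 / norm (x - c)) ^ n) * indicator (annulus c (exp (- (l + d))) 1) x)"
proof (cases "log_bump_grad l d (x - c) = 0")
  case True
  then show ?thesis using young by (simp add: young_function_def)
next
  case False
  let ?\<rho> = "norm (x - c)"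
  have \<rho>_range: "exp (- (l + d)) < ?\<rho>" "?\<rho> < exp (- l)"
    using log_bump_grad_eq_0[OF d_pos] False by (meson not_le)+
  have "?\<rho> < 1" using \<rho>_range(2) l_pos by (elim less_le_trans) simp
  then have in_annulus: "x \<in> annulus c (exp (- (l + d))) 1" using \<rho>_range(1) by (simp add: annulus_def)
  have in_ball: "x \<in> cball c (exp (- l))" using \<rho>_range(2) by (simp add: dist_norm norm_minus_commute)
  have "A t0 \<ge> 0" using nonneg by (intro young_function_nonneg[OF young]) simp
  have "A (h * norm (log_bump_grad l d (x - c))) \<le> A t0 + K * (2 * h / d) ^ n * (l + d) powr q * (1 / ?\<rho>) ^ n"
    using \<rho>_range(1) h_range d_pos mult_left_mono[OF norm_log_bump_grad_le[OF d_pos, of l "x - c"] h_range(1)]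
    by (intro young_function_inverse_le[OF young growth nonneg]) (auto simp: mult_ac)
  then have "ennreal (A (h * norm (log_bump_grad l d (x - c))))
      \<le> ennreal (A t0 + K * (2 * h / d) ^ n * (l + d) powr q * (1 / ?\<rho>) ^ n)" by (rule ennreal_leI)
  also have "\<dots> = ennreal (A t0) + ennreal (K * (2 * h / d) ^ n * (l + d) powr q) * ennreal ((1 / ?\<rho>) ^ n)"
    using \<open>A t0 \<ge> 0\<close> nonneg h_range d_pos by (subst ennreal_plus) (simp_all add: ennreal_mult')
  finally show ?thesis using in_annulus in_ball by simp
qed

lemma log_bump_energy_le:
  fixes c :: "'a::euclidean_space"
  assumes young: "young_function A" and growth: "\<And>t. t > t0 \<Longrightarrow> A t \<le> K * (t ^ DIM('a) * ln t powr q)"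
    and nonneg: "t0 \<ge> 1" "K \<ge> 0" "q \<ge> 0" and l_pos: "l > 0" and d_range: "d > 0" "l + d \<ge> 1"
    and h_range: "0 \<le> h" "2 * h \<le> d"
  shows "(\<integral>\<^sup>+x. ennreal (A (h * norm (log_bump_grad l d (x - c)))) \<partial>lborel)
    \<le> ennreal (unit_ball_vol DIM('a) * (A t0 + 4 ^ Suc DIM('a) * K)
        * (exp (- l) ^ DIM('a) + (h / d) ^ DIM('a) * (l + d) powr (q + 1)))"
proof -
  let ?n = "DIM('a)" and ?\<omega> = "unit_ball_vol DIM('a)"
  let ?tail = "(h / d) ^ ?n * (l + d) powr (q + 1)"
  define W where "W = K * (2 * h / d) ^ ?n * (l + d) powr q"
  have "W \<ge> 0" using nonneg h_range d_range by (simp add: W_def)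
  have "A t0 \<ge> 0" using nonneg by (intro young_function_nonneg[OF young]) simp
  have "(\<integral>\<^sup>+x. ennreal (A (h * norm (log_bump_grad l d (x - c)))) \<partial>lborel)
    \<le> (\<integral>\<^sup>+x. ennreal (A t0) * indicator (cball c (exp (- l))) x
      + ennreal W * (ennreal ((1 / norm (x - c)) ^ ?n) * indicator (annulus c (exp (- (l + d))) 1) x) \<partial>lborel)"
    unfolding W_def
    by (intro nn_integral_mono young_log_bump_grad_le[OF young growth nonneg l_pos d_range(1) h_range])
  also have "\<dots> = ennreal (A t0) * emeasure lborel (cball c (exp (- l)))
      + ennreal W * (\<integral>\<^sup>+x. ennreal ((1 / norm (x - c)) ^ ?n)
          * indicator (annulus c (exp (- (l + d))) 1) x \<partial>lborel)"
    by (subst nn_integral_add)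
      (simp_all add: nn_integral_cmult nn_integral_cmult_indicator borel_measurable_times_ennreal
        borel_measurable_indicator)
  also have "\<dots> \<le> ennreal (A t0) * ennreal (?\<omega> * exp (- l) ^ ?n) + ennreal W * ennreal (4 * (l + d) * 2 ^ ?n * ?\<omega>)"
    using nn_integral_inverse_power_annulus_le[OF d_range(2), of c]
    by (intro add_mono mult_left_mono) (simp_all add: emeasure_cball)
  also have "\<dots> = ennreal (A t0 * (?\<omega> * exp (- l) ^ ?n) + W * (4 * (l + d) * 2 ^ ?n * ?\<omega>))"
    using \<open>W \<ge> 0\<close> \<open>A t0 \<ge> 0\<close> l_pos d_range
    by (simp only: ennreal_mult'[symmetric]) (intro ennreal_plus[symmetric], auto)
  also have "W * (4 * (l + d) * 2 ^ ?n * ?\<omega>) = ?\<omega> * (4 ^ Suc ?n * K * ?tail)"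
  proof -
    have "(2 * h / d) ^ ?n * 2 ^ ?n = 4 ^ ?n * (h / d) ^ ?n" by (simp add: power_mult_distrib[symmetric])
    moreover have "(l + d) powr q * (l + d) = (l + d) powr (q + 1)" using d_range(2) by (simp add: powr_add)
    moreover have "W * (4 * (l + d) * 2 ^ ?n * ?\<omega>)
        = 4 * K * ?\<omega> * ((2 * h / d) ^ ?n * 2 ^ ?n) * ((l + d) powr q * (l + d))" by (simp only: W_def mult_ac)
    ultimately show ?thesis by (simp only: power_Suc mult_ac)
  qed
  also have "A t0 * (?\<omega> * exp (- l) ^ ?n) + ?\<omega> * (4 ^ Suc ?n * K * ?tail)
      \<le> ?\<omega> * (A t0 + 4 ^ Suc ?n * K) * (exp (- l) ^ ?n + ?tail)"
  proof -
    have "0 \<le> ?\<omega> * (A t0 * ?tail)" "0 \<le> ?\<omega> * (4 ^ Suc ?n * K * exp (- l) ^ ?n)"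
      using \<open>A t0 \<ge> 0\<close> nonneg h_range d_range by simp_all
    then show ?thesis unfolding distrib_left distrib_right by (simp only: mult_ac)
  qed
  finally show ?thesis by (simp add: ennreal_leI)
qed

lemma bounded_log_bump_energy:
  assumes young: "young_function A" and growth: "A \<in> O(\<lambda>t. t ^ DIM('a::euclidean_space) * ln t powr q)" and "q \<ge> 0"
  obtains C where "C \<ge> 0" "\<And>l d h (c::'a). \<lbrakk>l > 0; d > 0; l + d \<ge> 1; 0 \<le> h; 2 * h \<le> d\<rbrakk> \<Longrightarrow>
    (\<integral>\<^sup>+x. ennreal (A (h * norm (log_bump_grad l d (x - c)))) \<partial>lborel)
      \<le> ennreal (C * (exp (- l) ^ DIM('a) + (h / d) ^ DIM('a) * (l + d) powr (q + 1)))"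
proof -
  obtain CA where "CA > 0" and "\<forall>\<^sub>F t in at_top. norm (A t) \<le> CA * norm (t ^ DIM('a) * ln t powr q)"
    using landau_o.bigE[OF growth] by blast
  then obtain t0 where A_le: "\<And>t. t \<ge> t0 \<Longrightarrow> norm (A t) \<le> CA * norm (t ^ DIM('a) * ln t powr q)"
    unfolding eventually_at_top_linorder by blast
  have "A t \<le> CA * (t ^ DIM('a) * ln t powr q)" if "t > max 1 t0" for t
    using A_le[of t] that by (simp add: abs_mult)
  note energy = log_bump_energy_le[OF young this]
  have "A (max 1 t0) \<ge> 0" by (intro young_function_nonneg[OF young]) simp
  then show thesis using energy \<open>q \<ge> 0\<close> \<open>CA > 0\<close>
    by (intro that[of "unit_ball_vol DIM('a) * (A (max 1 t0) + 4 ^ Suc DIM('a) * CA)"]) auto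
qed

lemma young_function_bigo:
  assumes young: "young_function A" and "equiv_at_infinity A g"
  shows "A \<in> O(g)"
proof -
  obtain c t0 where "c > 0" and upper: "\<And>t. t > t0 \<Longrightarrow> A t \<le> c * g t"
    using assms(2) unfolding equiv_at_infinity_def by blast
  have "\<forall>\<^sub>F t in at_top. norm (A t) \<le> c * norm (g t)"
    using eventually_ge_at_top[of 0] eventually_gt_at_top[of t0]
  proof eventually_elim
    case (elim t)
    then have "norm (A t) \<le> c * g t" using upper young_function_nonneg[OF young] by simp
    also have "\<dots> \<le> c * norm (g t)" using \<open>c > 0\<close> by (intro mult_left_mono) auto
    finally show ?case .
  qed
  then show ?thesis by (rule bigoI)
qed

lemma ident_bigo_power_ln:
  assumes "n \<ge> 1" "q \<ge> 0"
  shows "(\<lambda>t::real. t) \<in> O(\<lambda>t. t ^ n * ln t powr q)"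
proof (rule bigoI[where c = 1])
  show "\<forall>\<^sub>F t::real in at_top. norm t \<le> 1 * norm (t ^ n * ln t powr q)"
    using eventually_ge_at_top[of "exp 1"]
  proof eventually_elim
    case (elim t)
    have "1 \<le> t" using elim exp_ge_add_one_self[of "1::real"] by linarith
    moreover have "1 \<le> ln t" using elim \<open>1 \<le> t\<close> by (simp add: ln_ge_iff)
    ultimately have "t * 1 \<le> t ^ n * ln t powr q"
      using assms power_increasing[of 1 n t] by (intro mult_mono) (auto simp: ge_one_powr_ge_zero)
    then show ?case using \<open>1 \<le> t\<close> by simp
  qed
qed

lemma norm_outer_product:
  fixes a b :: "real^'n::finite"
  shows "norm (\<chi> i. (a $ i) *\<^sub>R b) = norm a * norm b"
  by (simp add: norm_vec_def[of "\<chi> i. (a $ i) *\<^sub>R b"] norm_vec_def[of a] L2_set_left_distrib)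

locale separated_bumps =
  fixes P :: "'p set" and c v :: "'p \<Rightarrow> real^'n::finite" and V l d :: real
  assumes finite_P: "finite P" and d_pos: "d > 0"
    and norm_v_le: "\<And>p. norm (v p) \<le> V"
    and separated: "\<And>p p'. p \<in> P \<Longrightarrow> p' \<in> P \<Longrightarrow> p \<noteq> p' \<Longrightarrow> 2 * exp (- l) \<le> dist (c p) (c p')"
begin

definition field :: "real^'n \<Rightarrow> real^'n" where
  "field x = (\<Sum>p\<in>P. log_bump l d (x - c p) *\<^sub>R v p)"

definition grad :: "real^'n \<Rightarrow> real^'n^'n" where
  "grad x = (\<Sum>p\<in>P. \<chi> i. (v p $ i) *\<^sub>R log_bump_grad l d (x - c p))"

lemma sum_eq_single:
  fixes g :: "'p \<Rightarrow> 'b::comm_monoid_add"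
  assumes p_near: "p \<in> P" "norm (x - c p) < exp (- l)"
    and local: "\<And>p. exp (- l) \<le> norm (x - c p) \<Longrightarrow> g p = 0"
  shows "sum g P = g p"
proof -
  have "g p' = 0" if "p' \<in> P - {p}" for p'
  proof (rule local)
    have "2 * exp (- l) \<le> dist (c p') (c p)" using separated[of p' p] that p_near(1) by auto
    also have "\<dots> \<le> norm (x - c p') + norm (x - c p)"
      using dist_triangle2[of "c p'" "c p" x] by (simp add: dist_norm norm_minus_commute)
    finally show "exp (- l) \<le> norm (x - c p')" using p_near(2) by linarith
  qed
  then have "sum g (P - {p}) = 0" by (intro sum.neutral) auto
  then show ?thesis using sum.remove[OF finite_P p_near(1), of g] by simp
qed

lemma terms_eq_0_or_sum_eq_single:
  fixes g :: "'p \<Rightarrow> 'b::comm_monoid_add"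
  assumes local: "\<And>p. exp (- l) \<le> norm (x - c p) \<Longrightarrow> g p = 0"
  shows "(\<forall>p\<in>P. g p = 0) \<or> (\<exists>p\<in>P. norm (x - c p) < exp (- l) \<and> sum g P = g p)"
proof (cases "\<exists>p\<in>P. norm (x - c p) < exp (- l)")
  case True
  then obtain p where p_near: "p \<in> P" "norm (x - c p) < exp (- l)" by blast
  then have "sum g P = g p" using local by (rule sum_eq_single)
  then show ?thesis using p_near by blast
next
  case False
  then show ?thesis using local by (auto simp: not_less)
qed

lemma comp_sum:
  fixes g :: "'p \<Rightarrow> 'b::comm_monoid_add" and F :: "'b \<Rightarrow> 'd::comm_monoid_add"
  assumes local: "\<And>p. exp (- l) \<le> norm (x - c p) \<Longrightarrow> g p = 0" and "F 0 = 0"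
  shows "F (sum g P) = (\<Sum>p\<in>P. F (g p))"
proof (cases "\<forall>p\<in>P. g p = 0")
  case True
  then show ?thesis using \<open>F 0 = 0\<close> by simp
next
  case False
  then obtain p where p_near: "p \<in> P" "norm (x - c p) < exp (- l)" "sum g P = g p"
    using terms_eq_0_or_sum_eq_single[where x = x and g = g, OF local] by blast
  have "(\<Sum>p\<in>P. F (g p)) = F (g p)"
    using p_near(1,2) by (rule sum_eq_single) (simp add: local \<open>F 0 = 0\<close>)
  then show ?thesis using p_near(3) by simp
qed

lemma norm_sum_le:
  fixes g :: "'p \<Rightarrow> 'b::real_normed_vector"
  assumes local: "\<And>p. exp (- l) \<le> norm (x - c p) \<Longrightarrow> g p = 0" and g_le: "\<And>p. norm (g p) \<le> B"
  shows "norm (sum g P) \<le> B"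
proof (cases "\<forall>p\<in>P. g p = 0")
  case True
  then show ?thesis using order_trans[OF norm_ge_zero g_le] by simp
next
  case False
  then obtain p where "sum g P = g p" using terms_eq_0_or_sum_eq_single[where x = x and g = g, OF local] by blast
  then show ?thesis using g_le by simp
qed

lemma field_eq:
  assumes "p \<in> P" "norm (x - c p) \<le> exp (- (l + d))"
  shows "field x = v p"
proof -
  have "norm (x - c p) < exp (- l)" using assms(2) d_pos by (elim le_less_trans) simp
  then have "field x = log_bump l d (x - c p) *\<^sub>R v p"
    unfolding field_def using assms(1)
    by (intro sum_eq_single[where x = x]) (simp_all add: log_bump_eq_0[OF d_pos])
  then show ?thesis by (simp add: log_bump_eq_1[OF d_pos assms(2)])
qed

lemma norm_field_le: "norm (field x) \<le> V"
  unfolding field_def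
proof (rule norm_sum_le[where x = x])
  show "norm (log_bump l d (x - c p) *\<^sub>R v p) \<le> V" for p
  proof -
    have "\<bar>log_bump l d (x - c p)\<bar> * norm (v p) \<le> 1 * V"
      using log_bump_bounds[of l d "x - c p"] norm_v_le[of p] by (intro mult_mono) auto
    then show ?thesis by simp
  qed
qed (simp add: log_bump_eq_0[OF d_pos])

lemma has_derivative_field: "(field has_derivative (*v) (grad x)) (at x)"
proof -
  have "((\<lambda>x. log_bump l d (x - c p)) has_derivative (\<lambda>h. log_bump_grad l d (x - c p) \<bullet> h)) (at x)" for p
  proof -
    have "((\<lambda>x. x - c p) has_derivative (\<lambda>h. h)) (at x)" by (auto intro!: derivative_eq_intros)
    from has_derivative_compose[OF this has_derivative_log_bump[OF d_pos]] show ?thesis .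
  qed
  then have "(field has_derivative (\<lambda>h. \<Sum>p\<in>P. (log_bump_grad l d (x - c p) \<bullet> h) *\<^sub>R v p)) (at x)"
    unfolding field_def[abs_def] by (intro has_derivative_sum has_derivative_scaleR_left)
  moreover have "(\<Sum>p\<in>P. (log_bump_grad l d (x - c p) \<bullet> h) *\<^sub>R v p) = grad x *v h" for h
    by (simp add: vec_eq_iff grad_def matrix_vector_mul_component inner_sum_left mult.commute)
  ultimately show ?thesis by simp
qed

lemma continuous_on_field: "continuous_on UNIV field"
  using has_derivative_field by (meson continuous_at_imp_continuous_on has_derivative_continuous)

lemma outer_grad_eq_0:
  assumes "exp (- l) \<le> norm (x - c p)"
  shows "(\<chi> i. (v p $ i) *\<^sub>R log_bump_grad l d (x - c p)) = 0"
  using log_bump_grad_eq_0[OF d_pos, of l "x - c p"] assms by (simp add: vec_eq_iff)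

lemma norm_grad_le: "norm (grad x) \<le> V * (2 / d * exp (l + d))"
  unfolding grad_def
proof (rule norm_sum_le[where x = x, OF outer_grad_eq_0])
  show "norm (\<chi> i. (v p $ i) *\<^sub>R log_bump_grad l d (x - c p)) \<le> V * (2 / d * exp (l + d))" for p
    unfolding norm_outer_product
    using order_trans[OF norm_ge_zero norm_v_le]
    by (intro mult_mono norm_v_le norm_log_bump_grad_le_exp[OF d_pos]) auto
qed

lemma borel_measurable_grad [measurable]: "grad \<in> borel_measurable borel"
proof -
  have "(\<lambda>x. log_bump_grad l d (x - c p)) \<in> borel_measurable borel" for p by measurable
  moreover have "(\<lambda>w. \<chi> i. (v p $ i) *\<^sub>R w :: real^'n^'n) \<in> borel_measurable borel" for p
    by (intro borel_measurable_continuous_onI continuous_intros)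
  ultimately have "(\<lambda>x. \<chi> i. (v p $ i) *\<^sub>R log_bump_grad l d (x - c p) :: real^'n^'n)
      \<in> borel_measurable borel" for p
    by (rule measurable_compose)
  then show ?thesis unfolding grad_def[abs_def] by simp
qed

lemma energy_le:
  assumes young: "young_function A" and h_nonneg: "h \<ge> 0" and W_nonneg: "W \<ge> 0"
    and bump: "\<And>c :: real^'n. (\<integral>\<^sup>+x. ennreal (A (h * V * norm (log_bump_grad l d (x - c)))) \<partial>lborel) \<le> ennreal W"
  shows "(\<integral>\<^sup>+x. ennreal (A (norm (h *\<^sub>R grad x))) \<partial>lborel) \<le> ennreal (real (card P) * W)"
proof -
  let ?g = "\<lambda>p x. log_bump_grad l d (x - c p)"
  have [measurable]: "(\<lambda>x. h * V * norm (?g p x)) \<in> borel_measurable borel" for p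
    by measurable
  have nonneg: "0 \<le> h * V * norm (?g p x)" for p x
    using h_nonneg order_trans[OF norm_ge_zero norm_v_le] by simp
  have "A (norm (h *\<^sub>R grad x)) \<le> (\<Sum>p\<in>P. A (h * V * norm (?g p x)))" for x
  proof -
    have "A (norm (h *\<^sub>R grad x)) = (\<Sum>p\<in>P. A (norm (h *\<^sub>R (\<chi> i. (v p $ i) *\<^sub>R ?g p x))))"
      unfolding grad_def using young
      by (intro comp_sum[where F = "\<lambda>G. A (norm (h *\<^sub>R G))"] outer_grad_eq_0) (simp_all add: young_function_def)
    also have "\<dots> \<le> (\<Sum>p\<in>P. A (h * V * norm (?g p x)))"
      using h_nonneg norm_v_le by (intro sum_mono young_function_mono[OF young])
        (auto simp: norm_outer_product mult.assoc intro!: mult_left_mono mult_right_mono)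
    finally show ?thesis .
  qed
  then have "(\<integral>\<^sup>+x. ennreal (A (norm (h *\<^sub>R grad x))) \<partial>lborel)
      \<le> (\<integral>\<^sup>+x. (\<Sum>p\<in>P. ennreal (A (h * V * norm (?g p x)))) \<partial>lborel)"
    by (intro nn_integral_mono) (simp add: sum_ennreal young_function_nonneg[OF young nonneg] ennreal_leI)
  also have "\<dots> = (\<Sum>p\<in>P. \<integral>\<^sup>+x. ennreal (A (h * V * norm (?g p x))) \<partial>lborel)"
  proof (rule nn_integral_sum)
    show "(\<lambda>x. ennreal (A (h * V * norm (?g p x)))) \<in> borel_measurable lborel" for p
      using borel_measurable_young_function_norm[OF young, of "\<lambda>x. h * V * norm (?g p x)" lborel] nonneg by simp
  qed
  also have "\<dots> \<le> (\<Sum>p\<in>P. ennreal W)" by (intro sum_mono bump)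
  also have "\<dots> = ennreal (real (card P) * W)"
    using W_nonneg by (simp add: ennreal_mult' ennreal_of_nat_eq_real_of_nat)
  finally show ?thesis .
qed

end

section \<open>The Cantor set on the logarithmic scale\<close>

lemma exp_minus_le_quarter:
  assumes "2 \<le> (y::real)"
  shows "exp (- y) \<le> 1 / 4"
proof -
  have "(4::real) = 2\<^sup>2" by simp
  also have "\<dots> \<le> (exp 1)\<^sup>2" using exp_ge_add_one_self[of "1::real"] by (intro power_mono) auto
  also have "\<dots> = exp 2" by (simp add: exp_double[symmetric])
  also have "\<dots> \<le> exp y" using assms by simp
  finally show ?thesis by (simp add: exp_minus field_simps)
qed

locale log_cantor =
  fixes L \<tau> :: real and dim :: "'n::finite itself"
  assumes \<tau>_gt_1: "\<tau> > 1" and L_ge: "6 * real CARD('n) \<le> (\<tau> - 1) * L"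
begin

definition depth :: "nat \<Rightarrow> real" where "depth k = L * \<tau> ^ k"

definition radius :: "nat \<Rightarrow> real" where "radius k = exp (- depth k)"

definition \<epsilon> :: real where "\<epsilon> = (\<tau> - 1) / 3"

lemma CARD_ge_1: "1 \<le> real CARD('n)"
  using zero_less_card_finite[where 'a='n] by linarith

lemma L_pos: "L > 0"
proof -
  have "0 < (\<tau> - 1) * L" using L_ge CARD_ge_1 by linarith
  then show ?thesis using \<tau>_gt_1 by (simp add: zero_less_mult_iff)
qed

lemma \<epsilon>_pos: "\<epsilon> > 0"
  using \<tau>_gt_1 by (simp add: \<epsilon>_def)

lemma depth_pos: "depth k > 0"
  using L_pos \<tau>_gt_1 by (simp add: depth_def)

lemma depth_Suc: "depth (Suc k) = depth k + 3 * (\<epsilon> * depth k)"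
  by (simp add: depth_def \<epsilon>_def field_simps)

lemma depth_ge: "2 * real CARD('n) \<le> \<epsilon> * depth k"
proof -
  have "2 * real CARD('n) \<le> \<epsilon> * L" using L_ge by (simp add: \<epsilon>_def)
  also have "\<dots> \<le> \<epsilon> * depth k"
    using L_pos \<epsilon>_pos one_le_power[of \<tau> k] \<tau>_gt_1 by (intro mult_left_mono) (auto simp: depth_def)
  finally show ?thesis .
qed

lemma depth_ge_2: "2 \<le> \<epsilon> * depth k"
  using depth_ge[of k] CARD_ge_1 by linarith

sublocale radii: decaying_weights radius "1/4"
proof
  show "radius (Suc k) \<le> 1/4 * radius k" for k
  proof -
    have "radius (Suc k) = exp (- (3 * (\<epsilon> * depth k))) * radius k"
      by (simp add: radius_def depth_Suc exp_add[symmetric])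
    also have "\<dots> \<le> 1/4 * radius k"
      using depth_ge_2[of k] by (intro mult_right_mono exp_minus_le_quarter) (auto simp: radius_def)
    finally show ?thesis .
  qed
qed (auto simp: radius_def)

abbreviation cantor_point :: "(nat \<Rightarrow> bool^'n) \<Rightarrow> real^'n" where
  "cantor_point \<equiv> code_point radius"

lemma radius_le: "radius k \<le> (1/4) ^ k"
proof -
  have "radius k \<le> (1/4) ^ k * radius 0" using radii.s_add_le[of k 0] by simp
  also have "\<dots> \<le> (1/4) ^ k * 1" using depth_pos[of 0] by (intro mult_left_mono) (auto simp: radius_def)
  finally show ?thesis by simp
qed

text \<open>The cutoffs of level \<open>k\<close> rise from \<open>0\<close> to \<open>1\<close> while \<open>- ln (norm y)\<close> crosses the middle third of
  the interval from \<open>depth k\<close> to \<open>depth (Suc k)\<close>.\<close>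

definition inner_depth :: "nat \<Rightarrow> real" where "inner_depth k = (1 + \<epsilon>) * depth k"

lemma exp_inner_depth_le: "exp (- inner_depth k) \<le> 1/4 * radius k"
proof -
  have "exp (- inner_depth k) = exp (- (\<epsilon> * depth k)) * radius k"
    by (simp add: inner_depth_def radius_def exp_add[symmetric] algebra_simps)
  also have "\<dots> \<le> 1/4 * radius k"
    using depth_ge_2[of k] by (intro mult_right_mono exp_minus_le_quarter) (auto simp: radius_def)
  finally show ?thesis .
qed

text \<open>Words are extensional, so a word \<open>p\<close> is continued by the digit \<open>undefined\<close>, and \<open>cantor_point p\<close> is
  just some point of its cylinder.\<close>

sublocale level: separated_bumps "words (Suc k)" cantor_point "\<lambda>p. digit (p k)" "real CARD('n)"
    "inner_depth k" "\<epsilon> * depth k" for k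
proof
  show "2 * exp (- inner_depth k) \<le> dist (cantor_point p) (cantor_point p')"
    if "p \<in> words (Suc k)" "p' \<in> words (Suc k)" "p \<noteq> p'" for p p'
  proof -
    have "2 * exp (- inner_depth k) \<le> radii.gap * radius k"
      using exp_inner_depth_le[of k] radii.s_pos[of k] by (simp add: radii.gap_def)
    also have "\<dots> \<le> dist (cantor_point p) (cantor_point p')"
      using words_inj_cylinder that by (intro radii.dist_code_point_ge) blast
    finally show ?thesis .
  qed
qed (use finite_words \<epsilon>_pos depth_pos norm_digit_le in auto)

lemma field_cantor_point: "level.field k (cantor_point e) = digit (e k)"
proof -
  define p where "p = restrict e {..<Suc k}"
  have "p \<in> words (Suc k)" unfolding p_def by (rule restrict_in_words)
  moreover have "dist (cantor_point e) (cantor_point p) \<le> 2 * real CARD('n) * radius (Suc k)"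
    by (rule radii.dist_code_point_le) (simp add: cylinder_def p_def)
  moreover have "2 * real CARD('n) * radius (Suc k) \<le> exp (- (inner_depth k + \<epsilon> * depth k))"
  proof -
    have "2 * real CARD('n) \<le> exp (\<epsilon> * depth k)"
      using depth_ge[of k] exp_ge_add_one_self[of "\<epsilon> * depth k"] by linarith
    then have "2 * real CARD('n) * radius (Suc k) \<le> exp (\<epsilon> * depth k) * radius (Suc k)"
      by (rule mult_right_mono) (simp add: radius_def)
    also have "\<dots> = exp (- (inner_depth k + \<epsilon> * depth k))"
      by (simp add: radius_def inner_depth_def depth_Suc exp_add[symmetric] algebra_simps)
    finally show ?thesis .
  qed
  ultimately have "level.field k (cantor_point e) = digit (p k)"
    by (intro level.field_eq) (auto simp: dist_norm)
  then show ?thesis by (simp add: p_def)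
qed

lemma ln_radius_powr_tendsto:
  assumes balance: "\<tau> powr \<beta> = 1 / 2 ^ CARD('n)" and "a > 0"
  shows "(\<lambda>k. ln (1 / (a * radius k)) powr \<beta> * real CARD(bool^'n) ^ k) \<longlonglongrightarrow> L powr \<beta>"
proof -
  have "(\<lambda>k. (L - ln a * (1 / \<tau>) ^ k) powr \<beta>) \<longlonglongrightarrow> (L - ln a * 0) powr \<beta>"
    using \<tau>_gt_1 L_pos by (intro tendsto_intros LIMSEQ_realpow_zero) auto
  moreover have "(L - ln a * (1 / \<tau>) ^ k) powr \<beta> = ln (1 / (a * radius k)) powr \<beta> * real CARD(bool^'n) ^ k" for k
  proof -
    have "ln (1 / (a * radius k)) = \<tau> ^ k * (L - ln a * (1 / \<tau>) ^ k)"
      using \<open>a > 0\<close> \<tau>_gt_1 by (simp add: radius_def depth_def ln_div ln_mult power_one_over algebra_simps)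
    moreover have "(\<tau> ^ k) powr \<beta> * real CARD(bool^'n) ^ k = 1"
    proof -
      have "(\<tau> ^ k) powr \<beta> = (\<tau> powr \<beta>) ^ k"
        using \<tau>_gt_1 by (simp add: powr_realpow[symmetric] powr_powr mult.commute)
      then show ?thesis using balance by (simp add: power_mult_distrib[symmetric])
    qed
    ultimately show ?thesis by (simp add: powr_mult mult_ac)
  qed
  ultimately show ?thesis by simp
qed

lemma cantor_weight_bounds:
  assumes \<phi>_equiv: "equiv_near_zero \<phi> (\<lambda>r. ln (1 / r) powr \<beta>)" and balance: "\<tau> powr \<beta> = 1 / 2 ^ CARD('n)"
  obtains K K' where "K > 0" "\<And>a. a > 0 \<Longrightarrow> \<forall>\<^sub>F k in sequentially.
    K \<le> \<phi> (a * radius k) * real CARD(bool^'n) ^ k \<and> \<phi> (a * radius k) * real CARD(bool^'n) ^ k \<le> K'"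
proof -
  obtain c where "c > 0"
    and c_bounds: "\<forall>\<^sub>F r in at_right 0. ln (1 / r) powr \<beta> / c \<le> \<phi> r \<and> \<phi> r \<le> c * ln (1 / r) powr \<beta>"
    using equiv_near_zeroE[OF \<phi>_equiv] by blast
  have "L powr \<beta> > 0" using L_pos by simp
  have "\<forall>\<^sub>F k in sequentially. L powr \<beta> / 2 / c \<le> \<phi> (a * radius k) * real CARD(bool^'n) ^ k
      \<and> \<phi> (a * radius k) * real CARD(bool^'n) ^ k \<le> c * (2 * L powr \<beta>)" if "a > 0" for a
  proof -
    note limit = ln_radius_powr_tendsto[OF balance \<open>a > 0\<close>]
    have "\<forall>\<^sub>F k in sequentially. L powr \<beta> / 2 < ln (1 / (a * radius k)) powr \<beta> * real CARD(bool^'n) ^ k"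
      and "\<forall>\<^sub>F k in sequentially. ln (1 / (a * radius k)) powr \<beta> * real CARD(bool^'n) ^ k < 2 * L powr \<beta>"
      using \<open>L powr \<beta> > 0\<close> by (intro order_tendstoD[OF limit], simp)+
    with eventually_compose_filterlim[OF c_bounds radii.filterlim_scaled_at_right_0[OF \<open>a > 0\<close>]]
    show ?thesis
    proof eventually_elim
      case (elim k)
      let ?m = "real CARD(bool^'n) ^ k"
      have "L powr \<beta> / 2 / c \<le> ln (1 / (a * radius k)) powr \<beta> / c * ?m"
        using elim(2) \<open>c > 0\<close> by (simp add: field_simps)
      also have "\<dots> \<le> \<phi> (a * radius k) * ?m" using elim(1) by (intro mult_right_mono) auto
      finally have lower: "L powr \<beta> / 2 / c \<le> \<phi> (a * radius k) * ?m" .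
      have "\<phi> (a * radius k) * ?m \<le> c * ln (1 / (a * radius k)) powr \<beta> * ?m"
        using elim(1) by (intro mult_right_mono) auto
      also have "\<dots> \<le> c * (2 * L powr \<beta>)" using elim(3) \<open>c > 0\<close> by (simp add: mult.assoc)
      finally show ?case using lower by blast
    qed
  qed
  then show thesis using \<open>c > 0\<close> \<open>L powr \<beta> > 0\<close> by (intro that[of "L powr \<beta> / 2 / c"]) auto
qed

lemma hausdorff_gauge_cantor:
  assumes gauge: "gauge_function \<phi>" "equiv_near_zero \<phi> (\<lambda>r. ln (1 / r) powr \<beta>)"
    and balance: "\<tau> powr \<beta> = 1 / 2 ^ CARD('n)"
  shows "0 < hausdorff_gauge \<phi> (range cantor_point)" "hausdorff_gauge \<phi> (range cantor_point) < \<infinity>"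
proof -
  obtain K K' where "K > 0" and bounds: "\<And>a. a > 0 \<Longrightarrow> \<forall>\<^sub>F k in sequentially.
      K \<le> \<phi> (a * radius k) * real CARD(bool^'n) ^ k \<and> \<phi> (a * radius k) * real CARD(bool^'n) ^ k \<le> K'"
    using cantor_weight_bounds[OF gauge(2) balance] by blast
  have "ennreal K \<le> hausdorff_gauge \<phi> (range cantor_point)"
  proof (rule hausdorff_gauge_ge_coded[OF gauge(1) card_bool_vec_ge_2])
    show "0 < radii.gap * radius k" for k using radii.s_pos radii.gap_pos by simp
    show "(\<lambda>k. radii.gap * radius k) \<longlonglongrightarrow> 0" by (rule tendsto_mult_right_zero[OF radii.s_tendsto_0])
    show "\<forall>\<^sub>F k in sequentially. K \<le> \<phi> (radii.gap * radius k) * real CARD(bool^'n) ^ k"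
      using bounds[OF radii.gap_pos] by eventually_elim blast
  qed (rule radii.code_point_separated)
  then show "0 < hausdorff_gauge \<phi> (range cantor_point)"
    using \<open>K > 0\<close> by (elim less_le_trans[rotated]) simp
  have "hausdorff_gauge \<phi> (range cantor_point) \<le> ennreal K'"
  proof (rule hausdorff_gauge_le_coded[OF gauge(1)])
    show "0 \<le> 2 * real CARD('n) * radius k" for k using radii.s_pos[of k] by simp
    show "(\<lambda>k. 2 * real CARD('n) * radius k) \<longlonglongrightarrow> 0" by (rule tendsto_mult_right_zero[OF radii.s_tendsto_0])
    show "\<forall>\<^sub>F k in sequentially. \<phi> (2 * real CARD('n) * radius k) * real CARD(bool^'n) ^ k \<le> K'"
      using bounds[of "2 * real CARD('n)"] CARD_ge_1 by (auto elim: eventually_mono)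
  qed (rule radii.dist_code_point_le)
  then show "hausdorff_gauge \<phi> (range cantor_point) < \<infinity>" by (rule le_less_trans) simp
qed

lemma card_words_mult_exp_le_1:
  "real (card (words (Suc k) :: (nat \<Rightarrow> bool^'n) set)) * exp (- inner_depth k) ^ CARD('n) \<le> 1"
proof -
  have "exp (- inner_depth k) \<le> (1/4) ^ Suc k"
    using exp_inner_depth_le[of k] radius_le[of k] by simp
  then have "exp (- inner_depth k) ^ CARD('n) \<le> ((1/4) ^ Suc k) ^ CARD('n)" by (intro power_mono) auto
  also have "\<dots> = ((1/4) ^ CARD('n)) ^ Suc k" by (simp only: power_mult[symmetric] mult.commute)
  finally have "real (card (words (Suc k) :: (nat \<Rightarrow> bool^'n) set)) * exp (- inner_depth k) ^ CARD('n)
      \<le> (2 ^ CARD('n)) ^ Suc k * ((1/4) ^ CARD('n)) ^ Suc k"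
    unfolding card_words by (simp add: mult_left_mono)
  also have "\<dots> = ((1/2) ^ CARD('n)) ^ Suc k" by (simp only: power_mult_distrib[symmetric]) simp
  also have "\<dots> \<le> 1" by (intro power_le_one) auto
  finally show ?thesis .
qed

lemma level_weight_eq:
  assumes balance: "2 ^ CARD('n) * x ^ CARD('n) * \<tau> powr (q + 1 - real CARD('n)) = 1"
  shows "real (card (words (Suc k) :: (nat \<Rightarrow> bool^'n) set)) * ((x ^ k * real CARD('n) / (\<epsilon> * depth k)) ^ CARD('n)
      * (inner_depth k + \<epsilon> * depth k) powr (q + 1))
    = 2 ^ CARD('n) * (real CARD('n) / \<epsilon>) ^ CARD('n) * (1 + 2 * \<epsilon>) powr (q + 1) * L powr (q + 1 - real CARD('n))"
proof -
  let ?n = "CARD('n)" and ?y = "depth k"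
  have "(x ^ k * real ?n / (\<epsilon> * ?y)) ^ ?n = (real ?n / \<epsilon>) ^ ?n * (x ^ ?n) ^ k * ?y powr (- real ?n)"
  proof -
    have "(x ^ k * real ?n / (\<epsilon> * ?y)) ^ ?n = (real ?n / \<epsilon>) ^ ?n * (x ^ k) ^ ?n * inverse (?y ^ ?n)"
      by (simp add: power_mult_distrib power_divide power_inverse divide_inverse mult_ac)
    then show ?thesis
      using depth_pos[of k] by (simp add: powr_minus powr_realpow power_mult[symmetric] mult.commute)
  qed
  moreover have "(inner_depth k + \<epsilon> * ?y) powr (q + 1) = (1 + 2 * \<epsilon>) powr (q + 1) * ?y powr (q + 1)"
    by (simp add: inner_depth_def powr_mult[symmetric] algebra_simps)
  moreover have "?y powr (- real ?n) * ?y powr (q + 1) = L powr (q + 1 - real ?n) * (\<tau> powr (q + 1 - real ?n)) ^ k"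
  proof -
    have "?y powr (- real ?n) * ?y powr (q + 1) = ?y powr (q + 1 - real ?n)"
      by (simp add: powr_add[symmetric] algebra_simps)
    also have "\<dots> = L powr (q + 1 - real ?n) * (\<tau> ^ k) powr (q + 1 - real ?n)"
      by (simp add: depth_def powr_mult)
    also have "(\<tau> ^ k) powr (q + 1 - real ?n) = (\<tau> powr (q + 1 - real ?n)) ^ k"
      using \<tau>_gt_1 by (simp add: powr_realpow[symmetric] powr_powr mult.commute)
    finally show ?thesis .
  qed
  ultimately have "real (card (words (Suc k) :: (nat \<Rightarrow> bool^'n) set)) * ((x ^ k * real ?n / (\<epsilon> * ?y)) ^ ?n
      * (inner_depth k + \<epsilon> * ?y) powr (q + 1))
    = 2 ^ ?n * (real ?n / \<epsilon>) ^ ?n * (1 + 2 * \<epsilon>) powr (q + 1) * L powr (q + 1 - real ?n)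
      * (2 ^ ?n * x ^ ?n * \<tau> powr (q + 1 - real ?n)) ^ k"
    by (simp add: card_words power_mult_distrib mult_ac)
  then show ?thesis using balance by simp
qed

lemma bounded_level_energy:
  assumes young: "young_function A" "A \<in> O(\<lambda>t. t ^ CARD('n) * ln t powr q)" and "q \<ge> 0"
    and x_range: "0 < x" "x \<le> 1"
    and balance: "2 ^ CARD('n) * x ^ CARD('n) * \<tau> powr (q + 1 - real CARD('n)) = 1"
  obtains C where "C \<ge> 0" "\<And>k. (\<integral>\<^sup>+y. ennreal (A (norm (x ^ k *\<^sub>R level.grad k y))) \<partial>lebesgue) \<le> ennreal C"
proof -
  let ?n = "CARD('n)"
  let ?tail = "\<lambda>k. (x ^ k * real ?n / (\<epsilon> * depth k)) ^ ?n * (inner_depth k + \<epsilon> * depth k) powr (q + 1)"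
  note energy = bounded_log_bump_energy
    [where 'a = "real^'n", unfolded DIM_cart DIM_real mult_1_right, OF young \<open>q \<ge> 0\<close>]
  obtain C where "C \<ge> 0" and bump_energy: "\<And>l d h (c :: real^'n). \<lbrakk>l > 0; d > 0; l + d \<ge> 1; 0 \<le> h; 2 * h \<le> d\<rbrakk> \<Longrightarrow>
    (\<integral>\<^sup>+y. ennreal (A (h * norm (log_bump_grad l d (y - c)))) \<partial>lborel)
      \<le> ennreal (C * (exp (- l) ^ ?n + (h / d) ^ ?n * (l + d) powr (q + 1)))"
    by (rule energy) blast
  define W where "W = 2 ^ ?n * (real ?n / \<epsilon>) ^ ?n * (1 + 2 * \<epsilon>) powr (q + 1) * L powr (q + 1 - real ?n)"
  have "W \<ge> 0" using \<epsilon>_pos by (simp add: W_def)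
  have "(\<integral>\<^sup>+y. ennreal (A (norm (x ^ k *\<^sub>R level.grad k y))) \<partial>lborel) \<le> ennreal (C * (1 + W))" for k
  proof -
    have "x ^ k \<le> 1" using x_range by (intro power_le_one) auto
    then have "2 * (x ^ k * real ?n) \<le> 2 * real ?n" by simp
    then have "2 * (x ^ k * real ?n) \<le> \<epsilon> * depth k" using depth_ge[of k] by linarith
    moreover have "inner_depth k > 0" using \<epsilon>_pos depth_pos by (simp add: inner_depth_def)
    ultimately have "(\<integral>\<^sup>+y. ennreal (A (x ^ k * real ?n
          * norm (log_bump_grad (inner_depth k) (\<epsilon> * depth k) (y - c)))) \<partial>lborel)
        \<le> ennreal (C * (exp (- inner_depth k) ^ ?n + ?tail k))" for c :: "real^'n"
      using depth_ge_2[of k] x_range \<epsilon>_pos depth_pos by (intro bump_energy) auto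
    then have "(\<integral>\<^sup>+y. ennreal (A (norm (x ^ k *\<^sub>R level.grad k y))) \<partial>lborel)
        \<le> ennreal (real (card (words (Suc k) :: (nat \<Rightarrow> bool^'n) set))
          * (C * (exp (- inner_depth k) ^ ?n + ?tail k)))"
      using x_range \<open>C \<ge> 0\<close> \<epsilon>_pos depth_pos[of k] by (intro level.energy_le[OF young(1)]) auto
    also have "\<dots> \<le> ennreal (C * (1 + W))"
      using mult_left_mono[OF add_mono[OF card_words_mult_exp_le_1[of k]
        eq_refl[OF level_weight_eq[OF balance, of k]]] \<open>C \<ge> 0\<close>]
      by (intro ennreal_leI) (simp add: W_def algebra_simps)
    finally show ?thesis .
  qed
  then show thesis using \<open>C \<ge> 0\<close> \<open>W \<ge> 0\<close> by (intro that[of "C * (1 + W)"]) (auto simp: nn_integral_completion)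
qed

theorem level_series_in_V1A:
  assumes young: "young_function A" "A \<in> O(\<lambda>t. t ^ CARD('n) * ln t powr q)" and "q \<ge> 0"
    and x_range: "0 < x" "x \<le> 1"
    and balance: "2 ^ CARD('n) * x ^ CARD('n) * \<tau> powr (q + 1 - real CARD('n)) = 1"
    and weights: "\<And>k. 0 \<le> a k" "summable a" "suminf a \<le> 1"
  shows "(\<lambda>y. \<Sum>k. (a k * x ^ k) *\<^sub>R level.field k y) \<in> V1A A"
    and "continuous_on UNIV (\<lambda>y. \<Sum>k. (a k * x ^ k) *\<^sub>R level.field k y)"
proof -
  let ?f = "\<lambda>k y. x ^ k *\<^sub>R level.field k y" and ?F = "\<lambda>k y. x ^ k *\<^sub>R level.grad k y"
  have x_pow: "0 < x ^ k" "x ^ k \<le> 1" for k using x_range by (auto intro: power_le_one)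
  have meas_grad: "level.grad k \<in> borel_measurable lebesgue" for k by (intro measurable_completion) simp
  then have meas_F: "?F k \<in> borel_measurable lebesgue" for k by measurable
  have "CARD('n) \<ge> 1" by (simp add: Suc_le_eq)
  from bounded_level_energy[OF young_function_ident ident_bigo_power_ln[OF this \<open>q \<ge> 0\<close>] \<open>q \<ge> 0\<close> x_range balance]
  obtain C where L1_bound: "\<And>k. (\<integral>\<^sup>+y. ennreal (norm (?F k y)) \<partial>lebesgue) \<le> ennreal C" "C \<ge> 0" by blast
  from bounded_level_energy[OF young \<open>q \<ge> 0\<close> x_range balance]
  obtain D where energy: "\<And>k. (\<integral>\<^sup>+y. ennreal (A (norm (?F k y))) \<partial>lebesgue) \<le> ennreal D" by blast
  have "integrable lebesgue (level.grad k)" for k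
    using integrable_scaleR_right[OF integrable_if_nn_integral_norm_le(1)[OF meas_F L1_bound],
        of "inverse (x ^ k)" k] x_range by simp
  then have weak: "weak_gradient (?f k) (?F k)" for k
    by (intro weak_gradient_scaleR weak_gradient_has_derivative[OF level.has_derivative_field _
        level.borel_measurable_grad level.norm_grad_le])
  have norm_f: "norm (?f k y) \<le> real CARD('n)" for k y
    using mult_mono[OF x_pow(2) level.norm_field_le] x_pow(1)[of k] by (simp add: less_imp_le)
  have continuous_f: "continuous_on UNIV (?f k)" for k by (intro continuous_intros level.continuous_on_field)
  note series = V1A_suminf[OF young(1) weights continuous_f norm_f weak meas_F L1_bound energy]
  then show "(\<lambda>y. \<Sum>k. (a k * x ^ k) *\<^sub>R level.field k y) \<in> V1A A"
    "continuous_on UNIV (\<lambda>y. \<Sum>k. (a k * x ^ k) *\<^sub>R level.field k y)" by simp_all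
qed

end

section \<open>The image of the Cantor set\<close>

definition zipf :: "real \<Rightarrow> nat \<Rightarrow> real" where
  "zipf s k = real (Suc k) powr (- s) / (\<Sum>j. real (Suc j) powr (- s))"

context
  fixes s :: real
  assumes s_gt_1: "s > 1"
begin

lemma summable_Suc_powr: "summable (\<lambda>k. real (Suc k) powr (- s))"
  using s_gt_1 summable_Suc_iff[of "\<lambda>k. real k powr (- s)"] by (simp add: summable_real_powr_iff)

lemma suminf_Suc_powr_pos: "(\<Sum>k. real (Suc k) powr (- s)) > 0"
  by (rule suminf_pos[OF summable_Suc_powr]) simp

lemma zipf_pos: "zipf s k > 0"
  using suminf_Suc_powr_pos by (simp add: zipf_def)

lemma zipf_sums_1: "zipf s sums 1"
proof -
  let ?Z = "\<Sum>j. real (Suc j) powr (- s)"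
  have "(\<lambda>k. real (Suc k) powr (- s) / ?Z) sums (?Z / ?Z)"
    by (intro sums_divide summable_sums summable_Suc_powr)
  then show ?thesis using suminf_Suc_powr_pos by (simp add: zipf_def[abs_def])
qed

lemma zipf_Suc_le: "zipf s (Suc k) \<le> zipf s k"
  unfolding zipf_def using s_gt_1 suminf_Suc_powr_pos by (intro divide_right_mono powr_mono2') auto

lemma decaying_weights_zipf_power:
  assumes "0 < x" "x < 1/2"
  shows "decaying_weights (\<lambda>k. zipf s k * x ^ k) x"
proof
  show "zipf s (Suc k) * x ^ Suc k \<le> x * (zipf s k * x ^ k)" for k
    using mult_right_mono[OF zipf_Suc_le[of k], of "x ^ Suc k"] assms by (simp add: mult_ac)
qed (use assms zipf_pos in auto)

end

lemma powr_times_ln_powr_at_top: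
  fixes b \<eta> \<sigma> \<mu> :: real
  assumes "b > 0" "\<eta> > 0" "\<sigma> > 0" "\<mu> > 1 + \<sigma>"
  shows "filterlim (\<lambda>k. b * real (Suc k) powr (- (\<sigma> + 1))
    * (C + (1 + 1 / \<sigma>) * ln (real (Suc k)) + real k * \<eta>) powr \<mu>) at_top sequentially"
  using assms by real_asymp

lemma zipf_power_weight_eq:
  fixes b x \<sigma> m :: real and k :: nat
  defines "y \<equiv> b * (real (Suc k) powr (- (1 + 1 / \<sigma>)) * x ^ k)"
  assumes "b > 0" "x > 0" "\<sigma> > 0" "m > 0" and balance: "x powr \<sigma> = 1 / m"
  shows "y powr \<sigma> * m ^ k = b powr \<sigma> * real (Suc k) powr (- (\<sigma> + 1))"
    and "ln (1 / y) = - ln b + (1 + 1 / \<sigma>) * ln (real (Suc k)) + real k * - ln x"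
proof -
  let ?weight = "real (Suc k) powr (- (1 + 1 / \<sigma>))"
  have "- (1 + 1 / \<sigma>) * \<sigma> = - (\<sigma> + 1)" using \<open>\<sigma> > 0\<close> by (simp add: field_simps)
  then have "?weight powr \<sigma> = real (Suc k) powr (- (\<sigma> + 1))" by (simp only: powr_powr)
  moreover have "(x ^ k) powr \<sigma> * m ^ k = 1"
  proof -
    have "(x ^ k) powr \<sigma> = (x powr \<sigma>) ^ k"
      using \<open>x > 0\<close> by (simp add: powr_realpow[symmetric] powr_powr mult.commute)
    then show ?thesis using balance \<open>m > 0\<close> by (simp add: power_mult_distrib[symmetric])
  qed
  ultimately show "y powr \<sigma> * m ^ k = b powr \<sigma> * real (Suc k) powr (- (\<sigma> + 1))"
    by (simp only: y_def powr_mult mult.assoc mult_1_right)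
  have "ln y = ln b + (ln ?weight + ln (x ^ k))"
    unfolding y_def using \<open>b > 0\<close> \<open>x > 0\<close> by (simp add: ln_mult_pos del: of_nat_Suc)
  moreover have "ln ?weight = - (1 + 1 / \<sigma>) * ln (real (Suc k))" by (rule ln_powr)
  moreover have "ln (x ^ k) = real k * ln x" using \<open>x > 0\<close> by (simp add: ln_realpow)
  moreover have "ln (1 / y) = - ln y" using \<open>b > 0\<close> \<open>x > 0\<close> by (simp add: y_def ln_div)
  ultimately show "ln (1 / y) = - ln b + (1 + 1 / \<sigma>) * ln (real (Suc k)) + real k * - ln x"
    by (simp only:)
qed

lemma gauge_weight_at_top:
  fixes b x \<sigma> \<mu> m :: real and y :: "nat \<Rightarrow> real"
  assumes \<Phi>_equiv: "equiv_near_zero \<Phi> (\<lambda>r. r powr \<sigma> * ln (1 / r) powr \<mu>)"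
    and \<sigma>_pos: "\<sigma> > 0" and \<mu>_gt: "\<mu> > 1 + \<sigma>" and "b > 0" "m > 0"
    and x_balance: "0 < x" "x < 1" "x powr \<sigma> = 1 / m"
    and y_scale: "\<And>k. y k = b * (real (Suc k) powr (- (1 + 1 / \<sigma>)) * x ^ k)"
      "filterlim y (at_right 0) sequentially"
  shows "filterlim (\<lambda>k. \<Phi> (y k) * m ^ k) at_top sequentially"
proof -
  note weight = zipf_power_weight_eq[OF \<open>b > 0\<close> x_balance(1) \<sigma>_pos \<open>m > 0\<close> x_balance(3), folded y_scale(1)]
  obtain c where "c > 0"
    and c_bounds: "\<forall>\<^sub>F r in at_right 0. r powr \<sigma> * ln (1 / r) powr \<mu> / c \<le> \<Phi> r
      \<and> \<Phi> r \<le> c * (r powr \<sigma> * ln (1 / r) powr \<mu>)"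
    using equiv_near_zeroE[OF \<Phi>_equiv] by blast
  let ?lower = "\<lambda>k. b powr \<sigma> / c * real (Suc k) powr (- (\<sigma> + 1))
    * (- ln b + (1 + 1 / \<sigma>) * ln (real (Suc k)) + real k * - ln x) powr \<mu>"
  have "\<forall>\<^sub>F k in sequentially. ?lower k \<le> \<Phi> (y k) * m ^ k"
    using eventually_compose_filterlim[OF c_bounds y_scale(2)]
  proof eventually_elim
    case (elim k)
    have "?lower k = y k powr \<sigma> * m ^ k * ln (1 / y k) powr \<mu> / c"
      by (simp only: weight times_divide_eq_left)
    also have "\<dots> = y k powr \<sigma> * ln (1 / y k) powr \<mu> / c * m ^ k" by simp
    also have "\<dots> \<le> \<Phi> (y k) * m ^ k"
      using elim \<open>m > 0\<close> by (intro mult_right_mono conjunct1[OF elim]) simp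
    finally show ?case .
  qed
  moreover have "filterlim ?lower at_top sequentially"
    using \<open>b > 0\<close> \<open>c > 0\<close> x_balance(1,2) \<sigma>_pos \<mu>_gt by (intro powr_times_ln_powr_at_top) simp_all
  ultimately show ?thesis by (rule filterlim_at_top_mono[rotated])
qed

lemma hausdorff_gauge_code_point_zipf_power:
  fixes \<Phi> :: "real \<Rightarrow> real"
  assumes gauge: "gauge_function \<Phi>" "equiv_near_zero \<Phi> (\<lambda>r. r powr \<sigma> * ln (1 / r) powr \<mu>)"
    and \<sigma>_pos: "\<sigma> > 0" and \<mu>_gt: "\<mu> > 1 + \<sigma>"
    and x_balance: "0 < x" "x < 1/2" "x powr \<sigma> = 1 / 2 ^ CARD('n::finite)"
  shows "hausdorff_gauge \<Phi> (range (code_point (\<lambda>k. zipf (1 + 1 / \<sigma>) k * x ^ k) :: _ \<Rightarrow> real^'n)) = \<infinity>"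
proof -
  define h where "h k = zipf (1 + 1 / \<sigma>) k * x ^ k" for k
  have "1 + 1 / \<sigma> > 1" using \<sigma>_pos by simp
  interpret h: decaying_weights h x
    unfolding h_def by (rule decaying_weights_zipf_power[OF \<open>1 + 1 / \<sigma> > 1\<close> x_balance(1,2)])
  define b where "b = h.gap / (\<Sum>j. real (Suc j) powr (- (1 + 1 / \<sigma>)))"
  have "b > 0" using h.gap_pos suminf_Suc_powr_pos[OF \<open>1 + 1 / \<sigma> > 1\<close>] by (simp add: b_def)
  have "hausdorff_gauge \<Phi> (range (code_point h :: _ \<Rightarrow> real^'n)) = \<infinity>"
  proof (rule hausdorff_gauge_infinite_coded[OF gauge(1) card_bool_vec_ge_2])
    show "0 < h.gap * h k" for k using h.s_pos h.gap_pos by simp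
    show "(\<lambda>k. h.gap * h k) \<longlonglongrightarrow> 0" by (rule tendsto_mult_right_zero[OF h.s_tendsto_0])
    show "filterlim (\<lambda>k. \<Phi> (h.gap * h k) * real CARD(bool^'n) ^ k) at_top sequentially"
    proof (rule gauge_weight_at_top[OF gauge(2) \<sigma>_pos \<mu>_gt \<open>b > 0\<close>])
      show "h.gap * h k = b * (real (Suc k) powr (- (1 + 1 / \<sigma>)) * x ^ k)" for k
        by (simp add: h_def b_def zipf_def)
    qed (use x_balance h.filterlim_scaled_at_right_0[OF h.gap_pos] in simp_all)
  qed (rule h.code_point_separated)
  then show ?thesis unfolding h_def[abs_def] .
qed

lemma balanced_parameters:
  fixes n :: nat and q \<beta> \<sigma> :: real
  assumes n_ge_1: "n \<ge> 1" and q_gt: "q > real n - 1" and \<beta>_neg: "\<beta> < 0"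
    and \<sigma>_eq: "\<sigma> = real n * \<beta> / (real n - q - 1 + \<beta>)"
  obtains \<tau> x where "\<sigma> > 0" "\<tau> > 1" "0 < x" "x < 1/2" "\<tau> powr \<beta> = 1 / 2 ^ n" "x powr \<sigma> = 1 / 2 ^ n"
    "2 ^ n * x ^ n * \<tau> powr (q + 1 - real n) = 1"
proof -
  define \<tau> where "\<tau> = (2::real) powr (- real n / \<beta>)"
  define x where "x = (2::real) powr (- real n / \<sigma>)"
  have "real n - q - 1 + \<beta> < 0" using q_gt \<beta>_neg by simp
  then have "\<sigma> > 0" using n_ge_1 \<beta>_neg by (simp add: \<sigma>_eq divide_neg_neg mult_pos_neg)
  have n\<sigma>: "real n / \<sigma> = 1 - (q + 1 - real n) / \<beta>"
    using n_ge_1 \<beta>_neg \<open>real n - q - 1 + \<beta> < 0\<close> by (simp add: \<sigma>_eq field_simps)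
  have "(q + 1 - real n) / \<beta> < 0" using q_gt \<beta>_neg by (intro divide_pos_neg) auto
  show thesis
  proof (rule that[OF \<open>\<sigma> > 0\<close>])
    show "\<tau> > 1" using n_ge_1 \<beta>_neg by (simp add: \<tau>_def divide_pos_neg)
    show "0 < x" by (simp add: x_def)
    have "x < 2 powr (- 1)" unfolding x_def using n\<sigma> \<open>_ / \<beta> < 0\<close> by (intro powr_less_mono) auto
    then show "x < 1/2" by (simp add: powr_minus)
    show "\<tau> powr \<beta> = 1 / 2 ^ n"
      unfolding \<tau>_def powr_powr using \<beta>_neg by (simp add: powr_minus_divide powr_realpow)
    show "x powr \<sigma> = 1 / 2 ^ n"
      unfolding x_def powr_powr using \<open>\<sigma> > 0\<close> by (simp add: powr_minus_divide powr_realpow)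
    have "x ^ n = 2 powr (- real n / \<sigma> * real n)" by (simp add: x_def powr_powr powr_realpow[symmetric])
    then have "2 ^ n * x ^ n * \<tau> powr (q + 1 - real n)
        = 2 powr (real n + (- real n / \<sigma>) * real n + (- real n / \<beta>) * (q + 1 - real n))"
      by (simp only: \<tau>_def powr_powr powr_add powr_realpow zero_less_numeral)
    also have "real n + (- real n / \<sigma>) * real n + (- real n / \<beta>) * (q + 1 - real n)
        = real n * (1 - real n / \<sigma> - (q + 1 - real n) / \<beta>)"
      using \<beta>_neg \<open>\<sigma> > 0\<close> by (simp add: field_simps)
    finally show "2 ^ n * x ^ n * \<tau> powr (q + 1 - real n) = 1" by (simp add: n\<sigma>)
  qed
qed

theorem theorem6p2:
  fixes A \<phi> \<Phi> :: "real \<Rightarrow> real" and q \<beta> \<sigma> \<mu> :: real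
  assumes "young_function A"
    and "q > real CARD('n::finite) - 1"
    and "equiv_at_infinity A (\<lambda>t. t ^ CARD('n) * (ln t) powr q)"
    and "gauge_function \<phi>" and "\<beta> < 0"
    and "equiv_near_zero \<phi> (\<lambda>r. (ln (1 / r)) powr \<beta>)"
    and "\<sigma> = real CARD('n) * \<beta> / (real CARD('n) - q - 1 + \<beta>)"
    and "\<mu> > 1 + \<sigma>"
    and "gauge_function \<Phi>"
    and "equiv_near_zero \<Phi> (\<lambda>r. r powr \<sigma> * (ln (1 / r)) powr \<mu>)"
  shows "\<exists>(u :: real^'n \<Rightarrow> real^'n) (E :: (real^'n) set).
           u \<in> V1A A \<and> continuous_on UNIV u \<and> compact E \<and>
           0 < hausdorff_gauge \<phi> E \<and> hausdorff_gauge \<phi> E < \<infinity> \<and>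
           hausdorff_gauge \<Phi> (u ` E) = \<infinity>"
proof -
  have "CARD('n) \<ge> 1" by (simp add: Suc_le_eq)
  then have "q \<ge> 0" using assms(2) by linarith
  obtain \<tau> x where "\<sigma> > 0" "\<tau> > 1" and x_balance: "0 < x" "x < 1/2" "x powr \<sigma> = 1 / 2 ^ CARD('n)"
    and measure_balance: "\<tau> powr \<beta> = 1 / 2 ^ CARD('n)"
    and energy_balance: "2 ^ CARD('n) * x ^ CARD('n) * \<tau> powr (q + 1 - real CARD('n)) = 1"
    using balanced_parameters[OF \<open>CARD('n) \<ge> 1\<close> assms(2,5,7)] by metis
  interpret log_cantor "6 * real CARD('n) / (\<tau> - 1)" \<tau> "TYPE('n)"
    by standard (use \<open>\<tau> > 1\<close> in auto)
  define a where "a = zipf (1 + 1 / \<sigma>)"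
  define u where "u y = (\<Sum>k. (a k * x ^ k) *\<^sub>R level.field k y)" for y
  have weights: "0 \<le> a k" "summable a" "suminf a \<le> 1" for k
    using zipf_pos zipf_sums_1 \<open>\<sigma> > 0\<close> by (auto simp: a_def sums_iff less_imp_le)
  have "A \<in> O(\<lambda>t. t ^ CARD('n) * ln t powr q)"
    using assms(1,3) by (rule young_function_bigo)
  then have "u \<in> V1A A" "continuous_on UNIV u"
    unfolding u_def using level_series_in_V1A[OF assms(1) _ \<open>q \<ge> 0\<close> _ _ energy_balance weights] x_balance
    by simp_all
  moreover have "u (cantor_point e) = code_point (\<lambda>k. a k * x ^ k) e" for e
    unfolding u_def field_cantor_point by (simp add: code_point_def)
  then have "hausdorff_gauge \<Phi> (u ` range cantor_point) = \<infinity>"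
    using hausdorff_gauge_code_point_zipf_power[OF assms(9,10) \<open>\<sigma> > 0\<close> assms(8) x_balance]
    by (simp add: image_image a_def)
  ultimately show ?thesis
    using radii.compact_range_code_point hausdorff_gauge_cantor[OF assms(4,6) measure_balance] by blast
qed

end
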